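(* For every integer $w\ge0$, \[ \dim_K\mathfrak{Z}_{\mathcal{A}_K,w}\le D_{\mathcal{A}_K,w}. \]
   Context: Let $p$ be a prime, $q$ a power of $p$, $A=\mathbb{F}_q[\theta]$, $K=\mathbb{F}_q(\theta)$. Let $\mathbb{N}$ be the set of positive integers and $\mathcal{I}=\{\varnothing\}\cup\bigcup_{r\ge1}\mathbb{N}^r$ the set of indices; the weight of $\mathfrak{s}=(s_1,\dots,s_r)$ is $\mathrm{wt}(\mathfrak{s})=s_1+\cdots+s_r$, and $\mathrm{wt}(\varnothing)=0$. Empty sums are $0$. For $d\ge0$ and $s\in\mathbb{N}$ put $S_d(s)=\sum_{a\in A\text{ monic},\ \deg a=d}a^{-s}\in K$. Let $v$ run through the monic irreducible polynomials of $A$ and put $\mathcal{A}_K=\left(\prod_v A/(v)\right)/\left(\bigoplus_v A/(v)\right)$, a $K$-algebra via the natural embedding $K\hookrightarrow\mathcal{A}_K$ (reduce an element of $K$ modulo all $v$ not dividing its denominator). For a non-empty index $\mathfrak{s}=(s_1,\dots,s_r)$ the finite multiple zeta value is \[ \zeta_{\mathcal{A}_K}(\mathfrak{s})=\Big(\sum_{\deg v>d_1>\cdots>d_r\ge0}\prod_{i=1}^rS_{d_i}(s_i)\bmod v\Big)_v\in\mathcal{A}_K, \] and $\zeta_{\mathcal{A}_K}(\varnothing)=1$. For $w\ge0$, let $\mathfrak{Z}_{\mathcal{A}_K,w}$ be the $K$-linear span in $\mathcal{A}_K$ of all $\zeta_{\mathcal{A}_K}(\mathfrak{s})$ with $\mathfrak{s}\in\mathcal{I}$,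 $\mathrm{wt}(\mathfrak{s})=w$. The integers $D_{\mathcal{A}_K,w}$ ($w\ge0$) are defined by the power series expansion \[ \frac{1-X^{q-1}}{1-X-X^2-\cdots-X^q}=\sum_{w\ge0}D_{\mathcal{A}_K,w}X^w. \] *)

theory Defs
  imports
    "HOL-Library.Cardinality"
    "HOL-Computational_Algebra.Polynomial"
    "HOL-Computational_Algebra.Fraction_Field"
    "HOL-Computational_Algebra.Formal_Power_Series"
begin

text \<open>
  Throughout, \<open>'a :: {field, finite}\<close> is the field of \<open>q = CARD('a)\<close> elements,
  \<open>'a poly\<close> is \<open>A\<close> and \<open>'a poly fract\<close> is \<open>K\<close>.
\<close>

definition places :: "'a::{field,finite} poly set" where
  "places = {v. lead_coeff v = 1 \<and> irreducible v}"

subsection \<open>Arithmetic of residues\<close>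

lemma irreducible_bezout:
  fixes v b :: "'a::field poly"
  assumes v: "irreducible v" and b: "\<not> v dvd b"
  shows "\<exists>x y. x * v + y * b = 1"
proof -
  define I where "I = {g. g \<noteq> 0 \<and> (\<exists>x y. g = x * v + y * b)}"
  have "v = 1 * v + 0 * b" "v \<noteq> 0" using v by auto
  then have "v \<in> I" unfolding I_def by blast
  then obtain g where g: "g \<in> I" and gmin: "\<And>h. h \<in> I \<Longrightarrow> degree g \<le> degree h"
    using exists_least_iff[of "\<lambda>n. \<exists>g\<in>I. degree g = n"] by (metis linorder_not_le)
  obtain x y where gxy: "g = x * v + y * b" and "g \<noteq> 0"
    using g unfolding I_def by auto
  have gdvd: "g dvd s * v + t * b" for s t
  proof (rule ccontr)
    let ?z = "s * v + t * b"
    assume "\<not> g dvd ?z"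
    then have nz: "?z mod g \<noteq> 0" by (simp add: dvd_eq_mod_eq_0)
    have "?z mod g = ?z - (?z div g) * g" by (simp add: minus_div_mult_eq_mod)
    also have "\<dots> = (s - (?z div g) * x) * v + (t - (?z div g) * y) * b"
      by (subst (2) gxy) (simp add: algebra_simps)
    finally have "?z mod g \<in> I" using nz unfolding I_def by blast
    then have "degree g \<le> degree (?z mod g)" by (rule gmin)
    with degree_mod_less[OF \<open>g \<noteq> 0\<close>, of ?z] nz show False by auto
  qed
  have "g dvd v" using gdvd[of 1 0] by simp
  moreover have gb: "g dvd b" using gdvd[of 0 1] by simp
  ultimately have "v dvd g \<or> g dvd 1" using v irreducible_altdef by blast
  then have "g dvd 1" using gb b dvd_trans by blast
  then obtain k where "1 = g * k" by auto
  then have "(k * x) * v + (k * y) * b = 1" by (simp add: gxy algebra_simps)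
  then show ?thesis by blast
qed

lemma irreducible_dvd_mult:
  fixes v a b :: "'a::field poly"
  assumes v: "irreducible v" and "v dvd a * b"
  shows "v dvd a \<or> v dvd b"
proof (rule ccontr)
  assume n: "\<not> ?thesis"
  then obtain x y where xy: "x * v + y * b = 1" using irreducible_bezout[OF v] by blast
  have "a = a * (x * v + y * b)" by (simp add: xy)
  also have "\<dots> = v * (a * x) + (a * b) * y" by (simp add: algebra_simps)
  finally have "v dvd a" using assms(2) by (metis dvd_add dvd_mult2 dvd_triv_left)
  with n show False by simp
qed

lemma finite_degree_le: "finite {p :: 'a::{field,finite} poly. degree p \<le> n}"
proof -
  have "{p :: 'a poly. degree p \<le> n} \<subseteq> Poly ` {xs. set xs \<subseteq> UNIV \<and> length xs \<le> Suc n}"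
  proof
    fix p :: "'a poly" assume "p \<in> {p. degree p \<le> n}"
    then have "length (coeffs p) \<le> Suc n" by (cases "p = 0") (auto simp: length_coeffs_degree)
    then show "p \<in> Poly ` {xs. set xs \<subseteq> UNIV \<and> length xs \<le> Suc n}"
      by (intro image_eqI[of _ _ "coeffs p"]) auto
  qed
  then show ?thesis using finite_lists_length_le[of "UNIV :: 'a set" "Suc n"]
    by (meson finite finite_imageI finite_subset)
qed

lemma finite_places_dvd:
  assumes "b \<noteq> (0 :: 'a::{field,finite} poly)"
  shows "finite {v \<in> places. v dvd b}"
  by (rule finite_subset[OF _ finite_degree_le[of "degree b"]])
     (use assms dvd_imp_degree_le in auto)

lemma place_dvd_exists:
  fixes p :: "'a::{field,finite} poly"
  assumes "degree p > 0"
  shows "\<exists>v\<in>places. v dvd p"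
  using assms
proof (induction "degree p" arbitrary: p rule: less_induct)
  case less
  have pnz: "p \<noteq> 0" using less.prems by auto
  show ?case
  proof (cases "irreducible p")
    case True
    define v where "v = smult (inverse (lead_coeff p)) p"
    have pv: "p = smult (lead_coeff p) v" using pnz by (simp add: v_def)
    have "v dvd p" by (subst pv) (rule dvd_smult, simp)
    moreover have "p dvd v" unfolding v_def by (rule dvd_smult) simp
    moreover have "lead_coeff v = 1" using pnz by (simp add: v_def)
    moreover have "irreducible v"
      using True \<open>v dvd p\<close> \<open>p dvd v\<close> unfolding irreducible_altdef
      by (metis dvd_0_left dvd_trans)
    ultimately show ?thesis unfolding places_def by blast
  next
    case False
    have "\<not> p dvd 1" using less.prems by (auto simp: is_unit_iff_degree pnz)
    with False pnz obtain a b where ab: "p = a * b" "\<not> a dvd 1" "\<not> b dvd 1"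
      unfolding irreducible_def by blast
    with pnz have nz: "a \<noteq> 0" "b \<noteq> 0" by auto
    then have "degree a > 0" "degree b > 0" using ab by (auto simp: is_unit_iff_degree)
    moreover then have "degree a < degree p" using ab nz by (simp add: degree_mult_eq)
    ultimately obtain v where "v \<in> places" "v dvd a" using less.hyps by blast
    then show ?thesis using ab by (meson dvd_mult2)
  qed
qed

lemma infinite_places: "infinite (places :: 'a::{field,finite} poly set)"
proof
  assume fin: "finite (places :: 'a poly set)"
  define P :: "'a poly" where "P = \<Prod>places * monom 1 1"
  have nz: "(0 :: 'a poly) \<notin> places" by (auto simp: places_def)
  have "degree P > 0"
    using fin nz by (auto simp: P_def degree_mult_eq degree_monom_eq prod_zero_iff)
  then have "degree (P + 1) > 0" by (metis degree_1 degree_add_eq_left)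
  then obtain v where v: "v \<in> places" "v dvd P + 1" using place_dvd_exists by blast
  have "v dvd P" unfolding P_def using v fin by (auto intro: dvd_mult2 dvd_prodI[of _ v id, simplified])
  then have "v dvd 1" using v(2) by (metis dvd_add_right_iff)
  then show False using v(1) by (auto simp: places_def irreducible_def)
qed

subsection \<open>The ring \<open>\<A>\<^sub>K\<close>\<close>

text \<open>
  A family \<open>f\<close> of representatives stands for the element \<open>(f v mod v)\<^sub>v\<close> of
  \<open>\<Prod>\<^sub>v A/(v)\<close>; values of \<open>f\<close> outside \<^const>\<open>places\<close> are irrelevant. Two families give the
  same element of the quotient by \<open>\<Oplus>\<^sub>v A/(v)\<close> iff the components differ at only
  finitely many places.
\<close>

definition AK_rel ::
    "('a::{field,finite} poly \<Rightarrow> 'a poly) \<Rightarrow> ('a poly \<Rightarrow> 'a poly) \<Rightarrow> bool" where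
  "AK_rel f g \<longleftrightarrow> finite {v \<in> places. \<not> v dvd f v - g v}"

lemma AK_rel_refl: "AK_rel f f"
  by (simp add: AK_rel_def)

lemma AK_rel_by:
  assumes "finite E" "\<And>v. v \<in> places \<Longrightarrow> v \<notin> E \<Longrightarrow> v dvd f v - g v"
  shows "AK_rel f g"
  unfolding AK_rel_def by (rule finite_subset[OF _ assms(1)]) (use assms(2) in blast)

lemma AK_relE:
  assumes "AK_rel f g"
  obtains E where "finite E" "\<And>v. v \<in> places \<Longrightarrow> v \<notin> E \<Longrightarrow> v dvd f v - g v"
  using assms unfolding AK_rel_def by blast

quotient_type (overloaded) 'a AK =
  "'a::{field,finite} poly \<Rightarrow> 'a poly" / AK_rel
proof (rule equivpI)
  show "reflp (AK_rel :: ('a poly \<Rightarrow> 'a poly) \<Rightarrow> _)" by (simp add: reflp_def AK_rel_refl)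
  show "symp (AK_rel :: ('a poly \<Rightarrow> 'a poly) \<Rightarrow> _)"
    by (simp add: symp_def AK_rel_def dvd_diff_commute)
  show "transp (AK_rel :: ('a poly \<Rightarrow> 'a poly) \<Rightarrow> _)"
  proof (rule transpI)
    fix f g h :: "'a poly \<Rightarrow> 'a poly"
    assume "AK_rel f g" "AK_rel g h"
    then obtain E F where "finite E" "\<And>v. v \<in> places \<Longrightarrow> v \<notin> E \<Longrightarrow> v dvd f v - g v"
      "finite F" "\<And>v. v \<in> places \<Longrightarrow> v \<notin> F \<Longrightarrow> v dvd g v - h v"
      by (auto elim!: AK_relE)
    then show "AK_rel f h"
      by (intro AK_rel_by[of "E \<union> F"]) (use dvd_add in fastforce)+
  qed
qed

instantiation AK :: ("{field,finite}") comm_ring_1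
begin

lift_definition zero_AK :: "'a AK" is "\<lambda>_. 0" .
lift_definition one_AK :: "'a AK" is "\<lambda>_. 1" .

lift_definition plus_AK :: "'a AK \<Rightarrow> 'a AK \<Rightarrow> 'a AK" is "\<lambda>f g v. f v + g v"
proof -
  fix f f' g g' :: "'a poly \<Rightarrow> 'a poly"
  assume "AK_rel f f'" "AK_rel g g'"
  then obtain E F where *: "finite E" "\<And>v. v \<in> places \<Longrightarrow> v \<notin> E \<Longrightarrow> v dvd f v - f' v"
    "finite F" "\<And>v. v \<in> places \<Longrightarrow> v \<notin> F \<Longrightarrow> v dvd g v - g' v"
    by (auto elim!: AK_relE)
  show "AK_rel (\<lambda>v. f v + g v) (\<lambda>v. f' v + g' v)"
  proof (rule AK_rel_by[of "E \<union> F"])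
    fix v assume "v \<in> places" "v \<notin> E \<union> F"
    then have "v dvd (f v - f' v) + (g v - g' v)" using * by (intro dvd_add) auto
    then show "v dvd f v + g v - (f' v + g' v)" by (simp add: algebra_simps)
  qed (use * in auto)
qed

lift_definition uminus_AK :: "'a AK \<Rightarrow> 'a AK" is "\<lambda>f v. - f v"
  unfolding AK_rel_def minus_diff_minus dvd_minus_iff .

lift_definition minus_AK :: "'a AK \<Rightarrow> 'a AK \<Rightarrow> 'a AK" is "\<lambda>f g v. f v - g v"
proof -
  fix f f' g g' :: "'a poly \<Rightarrow> 'a poly"
  assume "AK_rel f f'" "AK_rel g g'"
  then obtain E F where *: "finite E" "\<And>v. v \<in> places \<Longrightarrow> v \<notin> E \<Longrightarrow> v dvd f v - f' v"
    "finite F" "\<And>v. v \<in> places \<Longrightarrow> v \<notin> F \<Longrightarrow> v dvd g v - g' v"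
    by (auto elim!: AK_relE)
  show "AK_rel (\<lambda>v. f v - g v) (\<lambda>v. f' v - g' v)"
  proof (rule AK_rel_by[of "E \<union> F"])
    fix v assume "v \<in> places" "v \<notin> E \<union> F"
    then have "v dvd (f v - f' v) - (g v - g' v)" using * by (intro dvd_diff[of v "f v - f' v"]) auto
    then show "v dvd f v - g v - (f' v - g' v)" by (simp add: algebra_simps)
  qed (use * in auto)
qed

lift_definition times_AK :: "'a AK \<Rightarrow> 'a AK \<Rightarrow> 'a AK" is "\<lambda>f g v. f v * g v"
proof -
  fix f f' g g' :: "'a poly \<Rightarrow> 'a poly"
  assume "AK_rel f f'" "AK_rel g g'"
  then obtain E F where *: "finite E" "\<And>v. v \<in> places \<Longrightarrow> v \<notin> E \<Longrightarrow> v dvd f v - f' v"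
    "finite F" "\<And>v. v \<in> places \<Longrightarrow> v \<notin> F \<Longrightarrow> v dvd g v - g' v"
    by (auto elim!: AK_relE)
  show "AK_rel (\<lambda>v. f v * g v) (\<lambda>v. f' v * g' v)"
  proof (rule AK_rel_by[of "E \<union> F"])
    fix v assume "v \<in> places" "v \<notin> E \<union> F"
    then have "v dvd (f v - f' v) * g v + f' v * (g v - g' v)" using *
      by (intro dvd_add) auto
    then show "v dvd f v * g v - f' v * g' v" by (simp add: algebra_simps)
  qed (use * in auto)
qed

instance
proof
  show "(0 :: 'a AK) \<noteq> 1"
  proof (transfer)
    have "{v \<in> places. \<not> v dvd (0 :: 'a poly) - 1} = places"
      by (auto simp: places_def irreducible_def)
    then show "\<not> AK_rel (\<lambda>_. 0) (\<lambda>_. 1 :: 'a poly)"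
      unfolding AK_rel_def using infinite_places by simp
  qed
qed (transfer; simp add: AK_rel_refl algebra_simps)+

end

subsection \<open>The \<open>K\<close>-algebra structure\<close>

text \<open>\<open>reduces_to v x c\<close>: \<open>x\<close> is integral at \<open>v\<close> and its image in \<open>A/(v)\<close> is the class of \<open>c\<close>.\<close>

definition reduces_to :: "'a::{field,finite} poly \<Rightarrow> 'a poly fract \<Rightarrow> 'a poly \<Rightarrow> bool" where
  "reduces_to v x c \<longleftrightarrow> (\<exists>a b. x = Fract a b \<and> \<not> v dvd b \<and> v dvd a - b * c)"

text \<open>A representative of \<open>x mod v\<close>, with the junk value \<open>0\<close> if \<open>x\<close> is not integral at \<open>v\<close>.\<close>

definition residue :: "'a::{field,finite} poly \<Rightarrow> 'a poly fract \<Rightarrow> 'a poly" where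
  "residue v x = (if \<exists>c. reduces_to v x c then SOME c. reduces_to v x c else 0)"

lemma places_irreducible: "v \<in> places \<Longrightarrow> irreducible v"
  by (simp add: places_def)

lemma reduces_to_Fract:
  assumes "v \<in> places" "\<not> v dvd b"
  shows "\<exists>c. reduces_to v (Fract a b) c"
proof -
  obtain x y where xy: "x * v + y * b = 1"
    using irreducible_bezout[OF places_irreducible] assms by blast
  have "a - b * (y * a) = a * (x * v + y * b) - b * (y * a)" by (simp add: xy)
  also have "\<dots> = v * (a * x)" by (simp add: algebra_simps)
  finally show ?thesis using assms unfolding reduces_to_def by (metis dvd_triv_left)
qed

lemma reduces_to_unique:
  assumes v: "v \<in> places" and "reduces_to v x c" "reduces_to v x c'"
  shows "v dvd c - c'"
proof -
  obtain a b a' b' where *: "x = Fract a b" "\<not> v dvd b" "v dvd a - b * c"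
    "x = Fract a' b'" "\<not> v dvd b'" "v dvd a' - b' * c'"
    using assms unfolding reduces_to_def by blast
  then have "b \<noteq> 0" "b' \<noteq> 0" by auto
  with * have eq: "a * b' = a' * b" by (auto simp: eq_fract)
  have "v dvd b * (a' - b' * c') - b' * (a - b * c)" 
    using * by (intro dvd_diff[of v "b * (a' - b' * c')"] dvd_mult)
  also have "b * (a' - b' * c') - b' * (a - b * c) = (a' * b - a * b') + (b * b') * (c - c')"
    by (simp add: algebra_simps)
  also have "\<dots> = (b * b') * (c - c')" by (simp add: eq)
  finally show ?thesis using irreducible_dvd_mult[OF places_irreducible[OF v]] * by blast
qed

lemma reduces_to_residue: "reduces_to v x c \<Longrightarrow> reduces_to v x (residue v x)"
  unfolding residue_def by (auto intro: someI)

lemma reduces_to_add: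
  assumes v: "v \<in> places" and "reduces_to v x c" "reduces_to v y d"
  shows "reduces_to v (x + y) (c + d)"
proof -
  obtain a b a' b' where *: "x = Fract a b" "\<not> v dvd b" "v dvd a - b * c"
    "y = Fract a' b'" "\<not> v dvd b'" "v dvd a' - b' * d"
    using assms unfolding reduces_to_def by blast
  then have "b \<noteq> 0" "b' \<noteq> 0" by auto
  with * have "x + y = Fract (a * b' + a' * b) (b * b')" by simp
  moreover have "\<not> v dvd b * b'" using irreducible_dvd_mult[OF places_irreducible[OF v]] * by blast
  moreover have "v dvd (a - b * c) * b' + (a' - b' * d) * b" using * by (intro dvd_add dvd_mult2)
  then have "v dvd a * b' + a' * b - (b * b') * (c + d)" by (simp add: algebra_simps)
  ultimately show ?thesis unfolding reduces_to_def by blast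
qed

lemma reduces_to_mult:
  assumes v: "v \<in> places" and "reduces_to v x c" "reduces_to v y d"
  shows "reduces_to v (x * y) (c * d)"
proof -
  obtain a b a' b' where *: "x = Fract a b" "\<not> v dvd b" "v dvd a - b * c"
    "y = Fract a' b'" "\<not> v dvd b'" "v dvd a' - b' * d"
    using assms unfolding reduces_to_def by blast
  then have "x * y = Fract (a * a') (b * b')" by simp
  moreover have "\<not> v dvd b * b'" using irreducible_dvd_mult[OF places_irreducible[OF v]] * by blast
  moreover have "v dvd (a - b * c) * a' + (a' - b' * d) * (b * c)"
    using * by (intro dvd_add dvd_mult2)
  then have "v dvd a * a' - (b * b') * (c * d)" by (simp add: algebra_simps)
  ultimately show ?thesis unfolding reduces_to_def by blast
qed

lemma reduces_to_poly: "v \<in> places \<Longrightarrow> reduces_to v (Fract c 1) c"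
  unfolding reduces_to_def
  by (intro exI[of _ c] exI[of _ 1]) (auto simp: places_def irreducible_def)

lemma residue_cong:
  assumes "v \<in> places" "reduces_to v x c"
  shows "v dvd residue v x - c"
  using assms reduces_to_residue reduces_to_unique by blast

lemma finite_not_integral: "finite {v \<in> places. \<not> (\<exists>c. reduces_to v x c)}"
proof (cases x)
  case (Fract a b)
  then show ?thesis
    by (intro finite_subset[OF _ finite_places_dvd[of b]]) (auto dest: reduces_to_Fract[of _ b a])
qed

lift_definition of_K :: "'a::{field,finite} poly fract \<Rightarrow> 'a AK" is "\<lambda>x v. residue v x" .

lemma of_K_add: "of_K (x + y) = of_K x + of_K y"
proof transfer
  fix x y :: "'a poly fract"
  let ?E = "{v \<in> places. \<not> (\<exists>c. reduces_to v x c)} \<union> {v \<in> places. \<not> (\<exists>c. reduces_to v y c)}"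
  show "AK_rel (\<lambda>v. residue v (x + y)) (\<lambda>v. residue v x + residue v y)"
    by (rule AK_rel_by[of ?E])
       (use finite_not_integral in \<open>auto intro!: residue_cong reduces_to_add intro: reduces_to_residue\<close>)
qed

lemma of_K_mult: "of_K (x * y) = of_K x * of_K y"
proof transfer
  fix x y :: "'a poly fract"
  let ?E = "{v \<in> places. \<not> (\<exists>c. reduces_to v x c)} \<union> {v \<in> places. \<not> (\<exists>c. reduces_to v y c)}"
  show "AK_rel (\<lambda>v. residue v (x * y)) (\<lambda>v. residue v x * residue v y)"
    by (rule AK_rel_by[of ?E])
       (use finite_not_integral in \<open>auto intro!: residue_cong reduces_to_mult intro: reduces_to_residue\<close>)
qed

lemma of_K_poly: "of_K (Fract c 1) = abs_AK (\<lambda>_. c)"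
proof -
  have "AK_rel (\<lambda>v. residue v (Fract c 1)) (\<lambda>_. c)"
    by (rule AK_rel_by[of "{}"]) (simp_all add: residue_cong reduces_to_poly)
  then show ?thesis by (simp add: of_K_def AK.abs_eq_iff)
qed

lemma of_K_1: "of_K 1 = 1"
  by (simp add: One_fract_def of_K_poly one_AK_def)

definition scale_AK :: "'a::{field,finite} poly fract \<Rightarrow> 'a AK \<Rightarrow> 'a AK" where
  "scale_AK k x = of_K k * x"

interpretation AK: vector_space scale_AK
  by standard (simp_all add: scale_AK_def distrib_left distrib_right mult.assoc of_K_add of_K_mult of_K_1)

subsection \<open>Finite multiple zeta values\<close>

definition power_sum :: "nat \<Rightarrow> nat \<Rightarrow> 'a::{field,finite} poly fract" where
  "power_sum d s = (\<Sum>a | lead_coeff a = 1 \<and> degree a = d. inverse (Fract a 1) ^ s)"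

definition indices :: "nat list set" where
  "indices = {ss. \<forall>s\<in>set ss. s \<ge> 1}"

definition decreasing_below :: "nat \<Rightarrow> nat \<Rightarrow> nat list set" where
  "decreasing_below n r = {ds. length ds = r \<and> sorted_wrt (>) ds \<and> (\<forall>d\<in>set ds. d < n)}"

definition truncated_mzv :: "nat \<Rightarrow> nat list \<Rightarrow> 'a::{field,finite} poly fract" where
  "truncated_mzv n ss =
     (\<Sum>ds\<in>decreasing_below n (length ss). \<Prod>i<length ss. power_sum (ds ! i) (ss ! i))"

lift_definition fmzv :: "nat list \<Rightarrow> 'a::{field,finite} AK" is
  "\<lambda>ss v. residue v (truncated_mzv (degree v) ss)" .

definition fmzv_space :: "nat \<Rightarrow> 'a::{field,finite} AK set" where
  "fmzv_space w = AK.span {fmzv ss | ss. ss \<in> indices \<and> sum_list ss = w}"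

definition D_AK :: "nat \<Rightarrow> nat \<Rightarrow> rat" where
  "D_AK q w = fps_nth ((1 - fps_X ^ (q - 1)) / (1 - (\<Sum>i=1..q. fps_X ^ i))) w"

subsection \<open>Adequacy of the conventions\<close>

lemma finite_decreasing_below: "finite (decreasing_below n r)"
  by (rule finite_subset[OF _ finite_lists_length_eq[of "{..<n}" r]])
     (auto simp: decreasing_below_def)

lemma fmzv_Nil: "fmzv [] = (1 :: 'a::{field,finite} AK)"
proof -
  have "truncated_mzv n [] = (1 :: 'a poly fract)" for n
  proof -
    have "decreasing_below n 0 = {[]}" by (auto simp: decreasing_below_def)
    then show ?thesis by (simp add: truncated_mzv_def)
  qed
  then have "fmzv [] = of_K (1 :: 'a poly fract)"
    by (simp add: fmzv_def of_K_def)
  then show ?thesis by (simp add: of_K_1)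
qed

text \<open>The junk value of \<^const>\<open>residue\<close> plays no role in \<^const>\<open>fmzv\<close>.\<close>

lemma integral_sum:
  assumes "v \<in> places" "\<And>i. i \<in> I \<Longrightarrow> \<exists>c. reduces_to v (f i) c"
  shows "\<exists>c. reduces_to v (sum f I) c"
  using assms(2)
proof (induction I rule: infinite_finite_induct)
  case (insert i I)
  then show ?case by (auto intro: reduces_to_add[OF assms(1)])
qed (use reduces_to_poly[OF assms(1), of 0] in \<open>auto simp: Zero_fract_def\<close>)

lemma integral_prod:
  assumes "v \<in> places" "\<And>i. i \<in> I \<Longrightarrow> \<exists>c. reduces_to v (f i) c"
  shows "\<exists>c. reduces_to v (prod f I) c"
  using assms(2)
proof (induction I rule: infinite_finite_induct)
  case (insert i I)
  then show ?case by (auto intro: reduces_to_mult[OF assms(1)])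
qed (use reduces_to_poly[OF assms(1), of 1] in \<open>auto simp: One_fract_def\<close>)

lemma integral_truncated_mzv:
  assumes v: "v \<in> places"
  shows "\<exists>c. reduces_to v (truncated_mzv (degree v) ss) c"
proof -
  have inv: "\<exists>c. reduces_to v (inverse (Fract a 1) ^ s) c"
    if a: "lead_coeff a = 1" "degree a < degree v" for a s
  proof -
    have "a \<noteq> 0" using a by auto
    then have "\<not> v dvd a" using a by (auto dest: dvd_imp_degree_le)
    then have "\<exists>c. reduces_to v (inverse (Fract a 1)) c"
      using reduces_to_Fract[OF v] by simp
    then show ?thesis
      using integral_prod[OF v, of "{..<s}" "\<lambda>_. inverse (Fract a 1)"] by simp
  qed
  show ?thesis
    unfolding truncated_mzv_def power_sum_def
    by (intro integral_sum[OF v] integral_prod[OF v] inv) (auto simp: decreasing_below_def)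
qed

text \<open>
  \<^const>\<open>AK.dim\<close> is \<open>0\<close> on infinite-dimensional spaces; the spaces at hand are finitely generated.
\<close>

lemma finite_indices: "finite {ss \<in> indices. sum_list ss = w}"
proof (rule finite_subset[OF _ finite_lists_length_le[of "{..w}" w]])
  have "length ss \<le> sum_list ss" if "ss \<in> indices" for ss
    using that by (induction ss) (auto simp: indices_def)
  then show "{ss \<in> indices. sum_list ss = w} \<subseteq> {xs. set xs \<subseteq> {..w} \<and> length xs \<le> w}"
    by (auto intro: member_le_sum_list)
qed simp

lemma finite_fmzv_generators: "finite {fmzv ss | ss. ss \<in> indices \<and> sum_list ss = w}"
  using finite_indices[of w] by (intro finite_image_set) simp

lemma D_AK_expansion:
  "Abs_fps (D_AK q) * (1 - (\<Sum>i=1..q. fps_X ^ i)) = 1 - fps_X ^ (q - 1)"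
proof -
  let ?d = "1 - (\<Sum>i=1..q. fps_X ^ i) :: rat fps"
  have "fps_nth ?d 0 = 1" by (simp add: fps_sum_nth)
  then have "?d dvd 1" by (simp add: fps_is_unit_iff)
  moreover have "Abs_fps (D_AK q) = (1 - fps_X ^ (q - 1)) / ?d"
    by (simp add: fps_eq_iff D_AK_def)
  ultimately show ?thesis by (metis dvd_div_mult_self unit_imp_dvd)
qed

end

theory Submission
  imports Defs
begin

text \<open>
  Put \<open>l\<^sub>d = (\<theta> - \<theta>\<^bsup>q\<^esup>) \<cdots> (\<theta> - \<theta>\<^bsup>q^d\<^esup>)\<close>. The logarithmic derivative of the Carlitz polynomials
  expresses every \<open>S\<^sub>d(s)\<close> through nested sums of powers of \<open>1/l\<^sub>d\<close>, so the span of the finite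
  multiple zeta values lies in that of the corresponding nested sums \<open>\<lambda>(s\<^sub>1,\<dots>,s\<^sub>r)\<close>, which
  multiply by the plain quasi-shuffle product \<open>*\<close> of words. Two families of relations suffice.
  Since \<open>\<lambda>(q-1)\<close> is \<open>l\<^sub>n\<close> times a \<open>v\<close>-integral element for \<open>n = deg v\<close>, it vanishes in
  \<open>\<A>\<^sub>K\<close>, hence \<open>\<lambda>((q-1) * u) = 0\<close>. The identity
  \<open>l\<^sub>d\<^bsup>-q\<^esup> = (\<theta> - \<theta>\<^bsup>q\<^esup>) l\<^bsub>d+1\<^esub>\<^bsup>-1\<^esup> \<Sum>\<^bsub>j\<le>d\<^esub> l\<^sub>j\<^bsup>-(q-1)\<^esup>\<close>, inserted behind a non-empty
  word \<open>p\<close>, gives \<open>\<lambda>(p,q+s,u) = - \<lambda>(p,q,s,u)\<close> and \<open>\<lambda>(p,q) = 0\<close> up to multiples of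
  \<open>\<theta> - \<theta>\<^bsup>q\<^esup>\<close>. Modulo \<open>\<theta>\<close> the first family makes the first letter smaller than \<open>q\<close>, the second
  makes all other letters at most \<open>q\<close> and the last one smaller than \<open>q\<close>; by Nakayama's lemma
  over \<open>\<F>\<^sub>q[\<theta>]\<close> localised at \<open>\<theta>\<close>, the remaining words, without the word \<open>(q-1)\<close>, span. Their
  generating function is \<open>(1 - X\<^bsup>q-1\<^esup>)/(1 - X - \<dots> - X\<^bsup>q\<^esup>)\<close>.
\<close>

section \<open>The q-power Frobenius on \<F>_q and on K\<close>

lemma one_less_CARD_field: "1 < CARD('a::{field,finite})"
proof -
  have "card {0, 1 :: 'a} \<le> CARD('a)" by (rule card_mono) auto
  then show ?thesis by simp
qed

lemma CARD_field_pos: "0 < CARD('a::{field,finite})"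
  using one_less_CARD_field[where 'a='a] by simp

text \<open>Multiplication by a nonzero c permutes the nonzero elements, so comparing their products
  gives c^(q-1) = 1.\<close>

lemma power_CARD_field:
  fixes c :: "'a::{field,finite}"
  shows "c ^ CARD('a) = c"
proof (cases "c = 0")
  case False
  have "(\<Prod>y\<in>UNIV - {0}. c * y) = (\<Prod>y\<in>UNIV - {0}. y)"
    by (rule prod.reindex_bij_witness[of _ "\<lambda>y. y / c" "\<lambda>y. c * y"]) (use False in auto)
  then have "c ^ (CARD('a) - 1) * \<Prod>(UNIV - {0 :: 'a}) = 1 * \<Prod>(UNIV - {0})"
    by (simp add: prod.distrib card_Diff_singleton)
  moreover have "\<Prod>(UNIV - {0 :: 'a}) \<noteq> 0" by (simp add: prod_zero_iff)
  ultimately have "c ^ (CARD('a) - 1) = 1" by simp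
  then show ?thesis
    using power_Suc[of c "CARD('a) - 1"] by simp
qed (simp add: zero_power)

text \<open>The polynomial \<open>(X + 1)\<^sup>q - X\<^sup>q - 1\<close> has degree below \<open>q\<close> and vanishes on the whole field.\<close>

lemma of_nat_choose_CARD_field:
  assumes "0 < k" "k < CARD('a::{field,finite})"
  shows "of_nat (CARD('a) choose k) = (0 :: 'a)"
proof -
  let ?q = "CARD('a)"
  define p :: "'a poly" where "p = (\<Sum>j\<in>{1..<?q}. monom (of_nat (?q choose j)) j)"
  have deg: "degree p < ?q"
    unfolding p_def using CARD_field_pos
    by (intro degree_sum_less) (auto intro: le_less_trans[OF degree_monom_le])
  have "poly p c = 0" for c
  proof -
    have "{..?q} = insert 0 (insert ?q {1..<?q})" using CARD_field_pos[where 'a='a] by auto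
    then have "(c + 1) ^ ?q = (\<Sum>j\<in>insert 0 (insert ?q {1..<?q}). of_nat (?q choose j) * c ^ j)"
      by (subst binomial_ring) simp
    also have "\<dots> = 1 + c ^ ?q + poly p c"
      by (simp add: p_def poly_sum poly_monom)
    finally show ?thesis by (simp add: power_CARD_field)
  qed
  then have "p = 0"
    using card_poly_roots_bound[of p] deg by fastforce
  then have "coeff p k = 0" by simp
  then show ?thesis using assms by (simp add: p_def coeff_sum if_distrib sum.delta)
qed

lemma power_CARD_add:
  fixes x y :: "'a::{field,finite} poly fract"
  shows "(x + y) ^ CARD('a) = x ^ CARD('a) + y ^ CARD('a)"
proof -
  let ?q = "CARD('a)"
  have zero: "of_nat (?q choose j) = (0 :: 'a poly fract)" if "j \<in> {1..<?q}" for j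
    using of_nat_choose_CARD_field[where 'a='a and k=j] that
    by (simp add: of_nat_fract of_nat_poly fract_collapse)
  have "{..?q} = insert 0 (insert ?q {1..<?q})" using CARD_field_pos[where 'a='a] by auto
  then have "(x + y) ^ ?q
      = (\<Sum>j\<in>insert 0 (insert ?q {1..<?q}). of_nat (?q choose j) * x ^ j * y ^ (?q - j))"
    by (subst binomial_ring) simp
  also have "\<dots> = x ^ ?q + y ^ ?q" by (simp add: zero)
  finally show ?thesis .
qed

text \<open>Expanding (x + (-x))^q = 0 treats even and odd characteristic alike.\<close>

lemma power_CARD_minus:
  fixes x :: "'a::{field,finite} poly fract"
  shows "(- x) ^ CARD('a) = - (x ^ CARD('a))"
  using power_CARD_add[of x "- x"] CARD_field_pos[where 'a='a]
  by (simp add: zero_power eq_neg_iff_add_eq_0 add.commute)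

lemma power_CARD_sum:
  fixes f :: "'b \<Rightarrow> 'a::{field,finite} poly fract"
  shows "sum f A ^ CARD('a) = (\<Sum>i\<in>A. f i ^ CARD('a))"
  by (induction A rule: infinite_finite_induct)
     (simp_all add: power_CARD_add zero_power CARD_field_pos)

lemma power_CARD_power_add:
  fixes x y :: "'a::{field,finite} poly fract"
  shows "(x + y) ^ (CARD('a) ^ i) = x ^ (CARD('a) ^ i) + y ^ (CARD('a) ^ i)"
  by (induction i) (simp_all add: power_mult power_CARD_add mult.commute[of "CARD('a)"])

lemma power_CARD_power_minus:
  fixes x :: "'a::{field,finite} poly fract"
  shows "(- x) ^ (CARD('a) ^ i) = - (x ^ (CARD('a) ^ i))"
  by (induction i) (simp_all add: power_mult power_CARD_minus mult.commute[of "CARD('a)"])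

lemma power_CARD_power_diff:
  fixes x y :: "'a::{field,finite} poly fract"
  shows "(x - y) ^ (CARD('a) ^ i) = x ^ (CARD('a) ^ i) - y ^ (CARD('a) ^ i)"
  using power_CARD_power_add[of x "- y" i] by (simp add: power_CARD_power_minus)

subsection \<open>Carlitz factorials\<close>

definition theta :: "'a::{field,finite} poly fract" where
  "theta = Fract [:0, 1:] 1"

text \<open>The classical [i]; for i > 0 it is the product of all monic irreducibles whose degree
  divides i.\<close>

definition bracket :: "nat \<Rightarrow> 'a::{field,finite} poly fract" where
  "bracket i = theta ^ (CARD('a) ^ i) - theta"

text \<open>The sign of each factor is chosen so that the inverse is exactly S_d(1), see
  \<open>power_sum_1\<close>.\<close>

definition carlitz_l :: "nat \<Rightarrow> 'a::{field,finite} poly fract" where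
  "carlitz_l d = (\<Prod>i=1..d. - bracket i)"

text \<open>The Carlitz factorial D_i, classically the product of all monic polynomials of degree
  i.\<close>

primrec carlitz_D :: "nat \<Rightarrow> 'a::{field,finite} poly fract" where
  "carlitz_D 0 = 1"
| "carlitz_D (Suc i) = bracket (Suc i) * carlitz_D i ^ CARD('a)"

definition inv_l :: "nat \<Rightarrow> 'a::{field,finite} poly fract" where
  "inv_l d = inverse (carlitz_l d)"

lemma Fract_power: "Fract a b ^ n = Fract (a ^ n) (b ^ n)"
  by (induction n) (simp_all add: One_fract_def)

lemma bracket_0 [simp]: "bracket 0 = 0"
  by (simp add: bracket_def)

lemma bracket_nonzero:
  assumes "0 < i"
  shows "bracket i \<noteq> (0 :: 'a::{field,finite} poly fract)"
proof
  have 1: "1 < CARD('a) ^ i"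
    by (rule one_less_power[OF one_less_CARD_field assms])
  assume "bracket i = (0 :: 'a poly fract)"
  then have "[:0, 1 :: 'a:] ^ (CARD('a) ^ i) = [:0, 1:]"
    by (simp add: bracket_def theta_def Fract_power Zero_fract_def eq_fract)
  then have "degree ([:0, 1 :: 'a:] ^ (CARD('a) ^ i)) = degree [:0, 1 :: 'a:]" by simp
  then show False using 1 by (auto simp: degree_power_eq)
qed

lemma carlitz_l_Suc: "carlitz_l (Suc d) = - bracket (Suc d) * carlitz_l d"
  by (simp add: carlitz_l_def)

lemma carlitz_l_nonzero: "carlitz_l d \<noteq> 0"
  by (auto simp: carlitz_l_def prod_zero_iff bracket_nonzero)

lemma carlitz_D_nonzero: "carlitz_D i \<noteq> 0"
  by (induction i) (auto simp: bracket_nonzero)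

lemma inv_l_0 [simp]: "inv_l 0 = 1"
  by (simp add: inv_l_def carlitz_l_def)

lemma inv_l_nonzero: "inv_l d \<noteq> 0"
  by (simp add: inv_l_def carlitz_l_nonzero)

lemma inv_l_Suc: "- bracket (Suc d) * inv_l (Suc d) = (inv_l d :: 'a::{field,finite} poly fract)"
  using bracket_nonzero[of "Suc d", where 'a='a] carlitz_l_nonzero[of d, where 'a='a]
  by (simp add: inv_l_def carlitz_l_Suc)

text \<open>Both sides are \<theta>^(q^d) - \<theta>^(q^i), since Frobenius is additive.\<close>

lemma bracket_diff:
  assumes "i \<le> d"
  shows "bracket d - bracket i = (bracket (d - i) :: 'a::{field,finite} poly fract) ^ (CARD('a) ^ i)"
  using assms
  by (simp add: bracket_def power_CARD_power_diff flip: power_mult power_add)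

text \<open>The source of everything below: the Frobenius twist of nested sums, the vanishing of
  \<lambda>(q-1) and the relations for letters at least q all come from it. The induction closes
  because [d+2] - [1] = [d+1]^q.\<close>

lemma sum_inv_l_power:
  "bracket 1 * inv_l (Suc d) * (\<Sum>j<Suc d. inv_l j ^ (CARD('a) - 1))
     = - (inv_l d ^ CARD('a) :: 'a::{field,finite} poly fract)"
proof (induction d)
  case 0
  then show ?case using inv_l_Suc[of 0, where 'a='a] by (simp add: minus_equation_iff[of "bracket _ * _"])
next
  case (Suc d)
  let ?q = "CARD('a)"
  let ?b = "inv_l (Suc (Suc d)) :: 'a poly fract" and ?a = "inv_l (Suc d) :: 'a poly fract"
  let ?s = "\<Sum>j<Suc d. inv_l j ^ (?q - 1) :: 'a poly fract"
  have a: "- bracket (Suc (Suc d)) * ?b = ?a" by (rule inv_l_Suc)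
  have d: "inv_l d = - bracket (Suc d) * ?a" by (rule inv_l_Suc[symmetric])
  have q: "?a * ?a ^ (?q - 1) = ?a ^ ?q"
    using power_Suc[of ?a "?q - 1"] CARD_field_pos[where 'a='a] by simp
  have br: "bracket (Suc (Suc d)) - bracket 1 = (bracket (Suc d) :: 'a poly fract) ^ ?q"
    using bracket_diff[of 1 "Suc (Suc d)", where 'a='a] by simp
  \<comment> \<open>The extra factor \<open>?a\<close> exposes the left side of the induction
    hypothesis and completes the power q-1 to q; it is nonzero and is cancelled at the end.\<close>
  have "?a * (bracket 1 * ?b * (?s + ?a ^ (?q - 1)))
      = ?b * (bracket 1 * ?a * ?s) + bracket 1 * ?b * (?a * ?a ^ (?q - 1))"
    by (simp add: algebra_simps)
  also have "\<dots> = ?b * (bracket (Suc d) ^ ?q + bracket 1) * ?a ^ ?q"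
    unfolding Suc.IH q d by (simp add: power_CARD_minus power_mult_distrib algebra_simps)
  also have "\<dots> = - (- bracket (Suc (Suc d)) * ?b) * ?a ^ ?q"
    by (simp flip: br)
  also have "\<dots> = ?a * - (?a ^ ?q)" unfolding a by simp
  finally have "bracket 1 * ?b * (?s + ?a ^ (?q - 1)) = - (?a ^ ?q)"
    using inv_l_nonzero[of "Suc d", where 'a='a] by (metis mult_left_cancel)
  then show ?case by simp
qed

subsection \<open>Nested sums of powers of inverse Carlitz factorials\<close>

primrec nested_sum :: "nat list \<Rightarrow> nat \<Rightarrow> 'a::{field,finite} poly fract" where
  "nested_sum [] n = 1"
| "nested_sum (s # u) n = (\<Sum>d<n. inv_l d ^ s * nested_sum u d)"

text \<open>The scalars do not depend on n, so they become genuine K-scalars once n = deg v is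
  inserted and the classes in A_K are taken.\<close>

inductive_set nested_space :: "nat \<Rightarrow> (nat \<Rightarrow> 'a::{field,finite} poly fract) set" for w :: nat where
  nested_space_gen: "u \<in> indices \<Longrightarrow> sum_list u = w \<Longrightarrow> nested_sum u \<in> nested_space w"
| nested_space_zero: "(\<lambda>n. 0) \<in> nested_space w"
| nested_space_add: "f \<in> nested_space w \<Longrightarrow> g \<in> nested_space w \<Longrightarrow> (\<lambda>n. f n + g n) \<in> nested_space w"
| nested_space_scale: "f \<in> nested_space w \<Longrightarrow> (\<lambda>n. c * f n) \<in> nested_space w"

text \<open>Functions of a single level d of the shape that S_d(s) will turn out to have. The
  positive exponent ensures that summing over d prepends an admissible letter.\<close>

inductive_set level_space :: "nat \<Rightarrow> (nat \<Rightarrow> 'a::{field,finite} poly fract) set" for w :: nat where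
  level_space_gen: "f \<in> nested_space m \<Longrightarrow> 0 < s \<Longrightarrow> s + m = w \<Longrightarrow> (\<lambda>d. inv_l d ^ s * f d) \<in> level_space w"
| level_space_zero: "(\<lambda>n. 0) \<in> level_space w"
| level_space_add: "f \<in> level_space w \<Longrightarrow> g \<in> level_space w \<Longrightarrow> (\<lambda>n. f n + g n) \<in> level_space w"

lemma Nil_in_indices: "[] \<in> indices"
  by (simp add: indices_def)

lemma Cons_in_indices: "s # u \<in> indices \<longleftrightarrow> 0 < s \<and> u \<in> indices"
  by (auto simp: indices_def)

lemma append_in_indices: "u @ v \<in> indices \<longleftrightarrow> u \<in> indices \<and> v \<in> indices"
  by (auto simp: indices_def)

lemma nested_space_one: "(\<lambda>n. 1 :: 'a::{field,finite} poly fract) \<in> nested_space 0"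
proof -
  have "nested_sum [] = (\<lambda>n. 1 :: 'a poly fract)" by auto
  moreover have "(nested_sum [] :: nat \<Rightarrow> 'a poly fract) \<in> nested_space 0"
    by (rule nested_space_gen) (simp_all add: Nil_in_indices)
  ultimately show ?thesis by simp
qed

lemma nested_space_iterate:
  fixes f :: "nat \<Rightarrow> 'a::{field,finite} poly fract"
  assumes "f \<in> nested_space m" "0 < s"
  shows "(\<lambda>n. \<Sum>d<n. inv_l d ^ s * f d) \<in> nested_space (s + m)"
  using assms(1)
proof induction
  case (nested_space_gen u)
  have "nested_sum (s # u) = (\<lambda>n. \<Sum>d<n. inv_l d ^ s * nested_sum u d :: 'a poly fract)"
    by auto
  moreover have "(nested_sum (s # u) :: nat \<Rightarrow> 'a poly fract) \<in> nested_space (s + m)"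
    using nested_space_gen assms(2)
    by (intro nested_space.nested_space_gen) (simp_all add: Cons_in_indices)
  ultimately show ?case by simp
next
  case nested_space_zero
  then show ?case by (simp add: nested_space.nested_space_zero)
next
  case (nested_space_add f g)
  then show ?case
    using nested_space.nested_space_add by (fastforce simp: distrib_left sum.distrib)
next
  case (nested_space_scale f c)
  have "(\<lambda>n. c * (\<Sum>d<n. inv_l d ^ s * f d)) \<in> nested_space (s + m)"
    by (intro nested_space.nested_space_scale nested_space_scale.IH)
  then show ?case by (simp add: sum_distrib_left mult.left_commute)
qed

text \<open>The square of index pairs is cut into its two open triangles and the diagonal, which is
  the origin of the quasi-shuffle product.\<close>

lemma sum_lessThan_mult:
  fixes f g :: "nat \<Rightarrow> 'b::comm_ring"
  shows "sum f {..<n} * sum g {..<n}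
    = (\<Sum>d<n. f d * sum g {..<d}) + (\<Sum>d<n. g d * sum f {..<d}) + (\<Sum>d<n. f d * g d)"
  by (induction n) (simp_all add: algebra_simps)

text \<open>According to which of the two largest indices dominates, or whether they agree, the
  product is an outer sum over a product of shorter total length.\<close>

lemma nested_sum_mult_in_nested_space:
  assumes "u \<in> indices" "v \<in> indices"
  shows "(\<lambda>n. nested_sum u n * nested_sum v n :: 'a::{field,finite} poly fract)
    \<in> nested_space (sum_list u + sum_list v)"
  using assms
proof (induction "length u + length v" arbitrary: u v rule: less_induct)
  case less
  show ?case
  proof (cases u)
    case Nil
    then show ?thesis using nested_space_gen[OF less.prems(2) refl] by simp
  next
    case u: (Cons s u')
    show ?thesis
    proof (cases v)
      case Nil
      then show ?thesis using nested_space_gen[OF less.prems(1) refl] by simp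
    next
      case v: (Cons t v')
      have st: "0 < s" "0 < t" "u' \<in> indices" "v' \<in> indices"
        using less.prems u v by (auto simp: Cons_in_indices)
      let ?w = "sum_list u + sum_list v"
      have "(\<lambda>n. nested_sum u' n * nested_sum v n :: 'a poly fract) \<in> nested_space (sum_list u' + sum_list v)"
        by (rule less.hyps) (use u st less.prems in auto)
      then have 1: "(\<lambda>n. \<Sum>d<n. inv_l d ^ s * (nested_sum u' d * nested_sum v d) :: 'a poly fract) \<in> nested_space ?w"
        using nested_space_iterate[OF _ st(1)] u by (fastforce simp: ac_simps)
      have "(\<lambda>n. nested_sum v' n * nested_sum u n :: 'a poly fract) \<in> nested_space (sum_list v' + sum_list u)"
        by (rule less.hyps) (use v st less.prems in auto)
      then have 2: "(\<lambda>n. \<Sum>d<n. inv_l d ^ t * (nested_sum v' d * nested_sum u d) :: 'a poly fract) \<in> nested_space ?w"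
        using nested_space_iterate[OF _ st(2)] v by (fastforce simp: ac_simps)
      have "(\<lambda>n. nested_sum u' n * nested_sum v' n :: 'a poly fract) \<in> nested_space (sum_list u' + sum_list v')"
        by (rule less.hyps) (use u v st in auto)
      then have 3: "(\<lambda>n. \<Sum>d<n. inv_l d ^ (s + t) * (nested_sum u' d * nested_sum v' d) :: 'a poly fract) \<in> nested_space ?w"
        using nested_space_iterate[of _ _ "s + t"] st u v by (fastforce simp: ac_simps)
      have "nested_sum u n * nested_sum v n
          = (\<Sum>d<n. inv_l d ^ s * (nested_sum u' d * nested_sum v d) :: 'a poly fract)
          + (\<Sum>d<n. inv_l d ^ t * (nested_sum v' d * nested_sum u d))
          + (\<Sum>d<n. inv_l d ^ (s + t) * (nested_sum u' d * nested_sum v' d))" for n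
        unfolding u v nested_sum.simps sum_lessThan_mult by (simp add: power_add mult_ac)
      then show ?thesis
        using nested_space_add[OF nested_space_add[OF 1 2] 3] by simp
    qed
  qed
qed

lemma nested_space_mult:
  assumes "f \<in> nested_space m" "g \<in> nested_space k"
  shows "(\<lambda>n. f n * g n) \<in> nested_space (m + k)"
  using assms(1)
proof induction
  case (nested_space_gen u)
  show ?case
    using assms(2)
  proof induction
    case (nested_space_gen v)
    then show ?case
      using nested_sum_mult_in_nested_space[of u v] \<open>u \<in> indices\<close> \<open>sum_list u = m\<close> by simp
  next
    case nested_space_zero
    then show ?case by (simp add: nested_space.nested_space_zero)
  next
    case (nested_space_add f g)
    then show ?case using nested_space.nested_space_add by (fastforce simp: distrib_left)
  next
    case (nested_space_scale f c)
    have "(\<lambda>n. c * (nested_sum u n * f n)) \<in> nested_space (m + k)"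
      by (intro nested_space.nested_space_scale nested_space_scale.IH)
    then show ?case by (simp add: mult.left_commute)
  qed
next
  case nested_space_zero
  then show ?case by (simp add: nested_space.nested_space_zero)
next
  case (nested_space_add f g)
  then show ?case using nested_space.nested_space_add by (fastforce simp: distrib_right)
next
  case (nested_space_scale f c)
  have "(\<lambda>n. c * (f n * g n)) \<in> nested_space (m + k)"
    by (intro nested_space.nested_space_scale nested_space_scale.IH)
  then show ?case by (simp add: mult.assoc)
qed

lemma nested_space_power:
  assumes "f \<in> nested_space m"
  shows "(\<lambda>n. f n ^ k) \<in> nested_space (k * m)"
proof (induction k)
  case 0
  then show ?case using nested_space_one by simp
next
  case (Suc k)
  then show ?case using nested_space_mult[OF assms Suc.IH] by simp
qed

lemma level_space_scale:
  assumes "g \<in> level_space w"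
  shows "(\<lambda>n. c * g n) \<in> level_space w"
  using assms
proof induction
  case (level_space_gen f m s)
  have "(\<lambda>d. inv_l d ^ s * (c * f d)) \<in> level_space w"
    using level_space_gen by (intro level_space.level_space_gen nested_space_scale)
  then show ?case by (simp add: mult.left_commute)
next
  case level_space_zero
  then show ?case by (simp add: level_space.level_space_zero)
next
  case (level_space_add f g)
  then show ?case using level_space.level_space_add by (fastforce simp: distrib_left)
qed

lemma level_space_mult_nested:
  assumes "g \<in> level_space w" "f \<in> nested_space m"
  shows "(\<lambda>n. g n * f n) \<in> level_space (w + m)"
  using assms(1)
proof induction
  case (level_space_gen h k s)
  have "(\<lambda>d. inv_l d ^ s * (h d * f d)) \<in> level_space (w + m)"
    using level_space_gen assms(2)
    by (intro level_space.level_space_gen[OF nested_space_mult[of _ k _ m]]) auto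
  then show ?case by (simp add: mult.assoc)
next
  case level_space_zero
  then show ?case by (simp add: level_space.level_space_zero)
next
  case (level_space_add f g)
  then show ?case using level_space.level_space_add by (fastforce simp: distrib_right)
qed

lemma level_space_mult:
  assumes "g \<in> level_space w" "h \<in> level_space k"
  shows "(\<lambda>n. g n * h n) \<in> level_space (w + k)"
  using assms(2)
proof induction
  case (level_space_gen f m s)
  show ?case
    using assms(1)
  proof induction
    case (level_space_gen f' m' s')
    have "(\<lambda>d. inv_l d ^ (s' + s) * (f' d * f d)) \<in> level_space (w + k)"
      using level_space_gen \<open>f \<in> nested_space m\<close> \<open>0 < s\<close> \<open>s + m = k\<close>
      by (intro level_space.level_space_gen[OF nested_space_mult[of _ m' _ m]]) auto
    then show ?case by (simp add: power_add mult_ac)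
  next
    case level_space_zero
    then show ?case by (simp add: level_space.level_space_zero)
  next
    case (level_space_add f g)
    then show ?case using level_space.level_space_add by (fastforce simp: distrib_right)
  qed
next
  case level_space_zero
  then show ?case by (simp add: level_space.level_space_zero)
next
  case (level_space_add f g)
  then show ?case using level_space.level_space_add by (fastforce simp: distrib_left)
qed

lemma level_space_sum:
  assumes "\<And>i. i \<in> I \<Longrightarrow> f i \<in> level_space w"
  shows "(\<lambda>n. \<Sum>i\<in>I. f i n) \<in> level_space w"
  using assms
  by (induction I rule: infinite_finite_induct)
     (simp_all add: level_space_zero level_space_add)

lemma sum_level_space_in_nested_space:
  assumes "g \<in> level_space w"
  shows "(\<lambda>n. \<Sum>d<n. g d) \<in> nested_space w"
  using assms
proof induction
  case (level_space_gen f m s)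
  then show ?case using nested_space_iterate[of f m s] by simp
next
  case level_space_zero
  then show ?case by (simp add: nested_space.nested_space_zero)
next
  case (level_space_add f g)
  then show ?case using nested_space_add by (fastforce simp: sum.distrib)
qed

section \<open>Frobenius twists of nested sums\<close>

lemma inv_l_power_CARD:
  "(inv_l d :: 'a::{field,finite} poly fract) ^ CARD('a) =
     - bracket 1 * inv_l (Suc d) * nested_sum [CARD('a) - 1] (Suc d)"
  using sum_inv_l_power[of d, where 'a='a] by simp

lemma CARD_minus_1_in_indices: "[CARD('a::{field,finite}) - 1] \<in> indices"
  using one_less_CARD_field[where 'a='a] by (simp add: indices_def)

text \<open>By \<open>inv_l_power_CARD\<close> the q-th power of 1/l_d is, up to a constant,
  1/l_(d+1) times a nested sum of weight q-1. Hence twisting moves each level up by one, which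
  explains the argument d - 1, and multiplies the weight by q.\<close>

lemma nested_sum_frobenius:
  assumes "u \<in> indices"
  shows "(\<lambda>d. nested_sum u (d - 1) ^ CARD('a) :: 'a::{field,finite} poly fract)
    \<in> nested_space (CARD('a) * sum_list u)"
  using assms
proof (induction u)
  case Nil
  then show ?case using nested_space_one by simp
next
  case (Cons s u)
  let ?q = "CARD('a)"
  let ?x = "nested_sum [?q - 1] :: nat \<Rightarrow> 'a poly fract"
  have s: "0 < s" "u \<in> indices" using Cons.prems by (auto simp: Cons_in_indices)
  define h :: "nat \<Rightarrow> 'a poly fract" where
    "h j = (- bracket 1) ^ s * (?x j ^ s * nested_sum u (j - 1) ^ ?q)" for j
  have "?x \<in> nested_space (?q - 1)"
    using nested_space_gen[OF CARD_minus_1_in_indices[where 'a='a] refl, where 'a='a] by simp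
  then have "h \<in> nested_space (s * (?q - 1) + ?q * sum_list u)"
    unfolding h_def
    by (intro nested_space_scale nested_space_mult[OF nested_space_power Cons.IH] s)
  then have "(\<lambda>n. \<Sum>d<n. inv_l d ^ s * h d) \<in> nested_space (s + (s * (?q - 1) + ?q * sum_list u))"
    using s by (intro nested_space_iterate)
  also have "s + (s * (?q - 1) + ?q * sum_list u) = ?q * sum_list (s # u)"
    using CARD_field_pos[where 'a='a] by (cases ?q) (auto simp: algebra_simps)
  also have "(\<lambda>n. \<Sum>d<n. inv_l d ^ s * h d) = (\<lambda>d. nested_sum (s # u) (d - 1) ^ ?q)"
  proof
    fix n
    \<comment> \<open>At level 0 the sum \<open>?x 0\<close> is empty and s > 0, so reindexing from
      d to d + 1 adds no term at the bottom and the truncated 0 - 1 does no harm.\<close>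
    have h0: "h 0 = 0" using s by (simp add: h_def zero_power)
    have hSuc: "inv_l (Suc d) ^ s * h (Suc d) = (inv_l d ^ s * nested_sum u d) ^ ?q" for d
    proof -
      have "(inv_l d ^ s * nested_sum u d) ^ ?q = (inv_l d ^ ?q) ^ s * nested_sum u d ^ ?q"
        by (simp add: power_mult_distrib mult.commute flip: power_mult)
      also have "\<dots> = inv_l (Suc d) ^ s * h (Suc d)"
        unfolding inv_l_power_CARD h_def by (simp only: power_mult_distrib diff_Suc_1 mult_ac)
      finally show ?thesis by simp
    qed
    show "(\<Sum>d<n. inv_l d ^ s * h d) = nested_sum (s # u) (n - 1) ^ ?q"
    proof (cases n)
      case 0
      then show ?thesis by (simp add: zero_power)
    next
      case (Suc m)
      then show ?thesis
        by (simp only: sum.lessThan_Suc_shift hSuc h0 diff_Suc_1 nested_sum.simps power_CARD_sum) simp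
    qed
  qed
  finally show ?case .
qed

lemma nested_space_frobenius:
  fixes f :: "nat \<Rightarrow> 'a::{field,finite} poly fract"
  assumes "f \<in> nested_space w"
  shows "(\<lambda>d. f (d - 1) ^ CARD('a)) \<in> nested_space (CARD('a) * w)"
  using assms
proof induction
  case (nested_space_gen u)
  then show ?case using nested_sum_frobenius by blast
next
  case nested_space_zero
  then show ?case by (simp add: nested_space.nested_space_zero zero_power)
next
  case (nested_space_add f g)
  then show ?case using nested_space.nested_space_add by (fastforce simp: power_CARD_add)
next
  case (nested_space_scale f c)
  then show ?case using nested_space.nested_space_scale by (fastforce simp: power_mult_distrib)
qed

text \<open>The value 0 at d = 0 is the one the twisted formula produces: there it contains a
  positive power of the empty sum \<open>?x 0\<close>.\<close>

lemma level_space_frobenius: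
  fixes g :: "nat \<Rightarrow> 'a::{field,finite} poly fract"
  assumes "g \<in> level_space w"
  shows "(\<lambda>d. if d = 0 then 0 else g (d - 1) ^ CARD('a)) \<in> level_space (CARD('a) * w)"
  using assms
proof induction
  case (level_space_gen f m s)
  let ?q = "CARD('a)"
  let ?x = "nested_sum [?q - 1] :: nat \<Rightarrow> 'a poly fract"
  have "?x \<in> nested_space (?q - 1)"
    using nested_space_gen[OF CARD_minus_1_in_indices[where 'a='a] refl, where 'a='a] by simp
  then have "(\<lambda>d. (- bracket 1) ^ s * (?x d ^ s * f (d - 1) ^ ?q)) \<in> nested_space (s * (?q - 1) + ?q * m)"
    by (intro nested_space_scale level_space_gen
        nested_space_mult[OF nested_space_power nested_space_frobenius])
  then have "(\<lambda>d. inv_l d ^ s * ((- bracket 1) ^ s * (?x d ^ s * f (d - 1) ^ ?q))) \<in> level_space (?q * w)"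
    by (rule level_space.level_space_gen)
       (use level_space_gen CARD_field_pos[where 'a='a] in
         \<open>cases ?q; auto simp: algebra_simps\<close>)+
  also have "(\<lambda>d. inv_l d ^ s * ((- bracket 1) ^ s * (?x d ^ s * f (d - 1) ^ ?q)))
      = (\<lambda>d. if d = 0 then 0 else (inv_l (d - 1) ^ s * f (d - 1)) ^ ?q)"
  proof
    fix d :: nat
    show "inv_l d ^ s * ((- bracket 1) ^ s * (?x d ^ s * f (d - 1) ^ ?q))
      = (if d = 0 then 0 else (inv_l (d - 1) ^ s * f (d - 1)) ^ ?q)"
    proof (cases d)
      case 0
      then show ?thesis using level_space_gen by (simp add: zero_power)
    next
      case (Suc j)
      have "(inv_l j ^ s * f j) ^ ?q = (inv_l j ^ ?q) ^ s * f j ^ ?q"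
        by (simp add: power_mult_distrib mult.commute flip: power_mult)
      also have "\<dots> = inv_l d ^ s * ((- bracket 1) ^ s * (?x d ^ s * f j ^ ?q))"
        unfolding inv_l_power_CARD Suc by (simp only: power_mult_distrib mult_ac)
      finally show ?thesis using Suc by simp
    qed
  qed
  finally show ?case .
next
  case level_space_zero
  then show ?case by (simp add: level_space.level_space_zero zero_power cong: if_cong)
next
  case (level_space_add f g)
  have "(\<lambda>d. (if d = 0 then 0 else f (d - 1) ^ CARD('a)) + (if d = 0 then 0 else g (d - 1) ^ CARD('a)))
      \<in> level_space (CARD('a) * w)"
    by (intro level_space.level_space_add level_space_add.IH)
  also have "(\<lambda>d. (if d = 0 then 0 else f (d - 1) ^ CARD('a)) + (if d = 0 then 0 else g (d - 1) ^ CARD('a)))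
      = (\<lambda>d. if d = 0 then 0 else (f (d - 1) + g (d - 1)) ^ CARD('a))"
    by (auto simp: power_CARD_add)
  finally show ?case .
qed

section \<open>The quasi-shuffle product with a single letter\<close>

primrec insert_letter :: "nat \<Rightarrow> nat list \<Rightarrow> nat list list" where
  "insert_letter c [] = [[c]]"
| "insert_letter c (s # u) = (c # s # u) # ((c + s) # u) # map ((#) s) (insert_letter c u)"

lemma sum_list_nested_sum_Cons:
  "(\<Sum>x\<leftarrow>xs. nested_sum (s # x) n :: 'a::{field,finite} poly fract)
     = (\<Sum>d<n. inv_l d ^ s * (\<Sum>x\<leftarrow>xs. nested_sum x d))"
  by (induction xs) (simp_all add: distrib_left sum.distrib)

text \<open>The three parts of \<open>sum_lessThan_mult\<close> put c above s, merge it with s, or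
  push it below s, where the induction hypothesis applies. Lists rather than sets of words keep the
  multiplicities.\<close>

lemma nested_sum_insert_letter:
  "nested_sum [c] n * nested_sum u n
     = (\<Sum>x\<leftarrow>insert_letter c u. nested_sum x n :: 'a::{field,finite} poly fract)"
proof (induction u arbitrary: n)
  case (Cons s u)
  have "(\<Sum>x\<leftarrow>insert_letter c u. nested_sum (s # x) n :: 'a poly fract)
      = (\<Sum>d<n. inv_l d ^ s * (\<Sum>x\<leftarrow>insert_letter c u. nested_sum x d))"
    by (rule sum_list_nested_sum_Cons)
  also have "\<dots> = (\<Sum>d<n. inv_l d ^ s * nested_sum u d * nested_sum [c] d)"
    by (simp only: Cons.IH[symmetric]) (simp only: mult_ac)
  finally have "(\<Sum>x\<leftarrow>insert_letter c u. nested_sum (s # x) n :: 'a poly fract) = \<dots>" .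
  moreover have "nested_sum [c] n * nested_sum (s # u) n
      = (nested_sum (c # s # u) n :: 'a poly fract) + (\<Sum>d<n. inv_l d ^ s * nested_sum u d * nested_sum [c] d)
        + nested_sum ((c + s) # u) n"
    unfolding nested_sum.simps sum_lessThan_mult by (simp add: power_add mult_ac)
  ultimately show ?case by (simp add: o_def add_ac)
qed simp

subsection \<open>Carlitz polynomials and power sums\<close>

text \<open>Coefficients of the \<F>_q-linear Carlitz polynomial E_d, which sends a polynomial of
  degree at most d to its coefficient at \<theta>^d (\<open>carlitz_eval_poly\<close>). The value 0
  for i > d lets the two recursions hold without bounds on i.\<close>

definition carlitz_coeff :: "nat \<Rightarrow> nat \<Rightarrow> 'a::{field,finite} poly fract" where
  "carlitz_coeff d i =
     (if i \<le> d then inverse (carlitz_D i * carlitz_l (d - i) ^ (CARD('a) ^ i)) else 0)"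

definition carlitz_eval :: "nat \<Rightarrow> 'a::{field,finite} poly fract \<Rightarrow> 'a poly fract" where
  "carlitz_eval d x = (\<Sum>i\<le>d. carlitz_coeff d i * x ^ (CARD('a) ^ i))"

lemma carlitz_coeff_0: "carlitz_coeff d 0 = inv_l d"
  by (simp add: carlitz_coeff_def inv_l_def)

lemma bracket_carlitz_coeff_Suc:
  "bracket (Suc i) * carlitz_coeff (Suc d) (Suc i)
     = (carlitz_coeff d i :: 'a::{field,finite} poly fract) ^ CARD('a)"
proof (cases "i \<le> d")
  case True
  have "carlitz_coeff (Suc d) (Suc i) = (inverse (bracket (Suc i)) * carlitz_coeff d i ^ CARD('a)
      :: 'a poly fract)"
    using True by (simp add: carlitz_coeff_def power_mult_distrib power_mult mult.commute[of "CARD('a)"]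
        flip: power_inverse)
  then show ?thesis using bracket_nonzero[of "Suc i", where 'a='a] by simp
qed (simp add: carlitz_coeff_def zero_power)

lemma bracket_diff_carlitz_coeff:
  "(bracket (Suc d) - bracket i) * carlitz_coeff (Suc d) i
     = - (carlitz_coeff d i :: 'a::{field,finite} poly fract)"
proof (cases "i \<le> d")
  case True
  let ?Q = "CARD('a) ^ i"
  have d: "Suc d - i = Suc (d - i)" using True by simp
  have "bracket (Suc d) - bracket i = (bracket (Suc (d - i)) :: 'a poly fract) ^ ?Q"
    using bracket_diff[of i "Suc d", where 'a='a] True d by simp
  moreover have "carlitz_l (Suc d - i) ^ ?Q
      = - ((bracket (Suc (d - i)) :: 'a poly fract) ^ ?Q * carlitz_l (d - i) ^ ?Q)"
    unfolding d carlitz_l_Suc by (simp add: power_mult_distrib power_CARD_power_minus)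
  ultimately show ?thesis
    using True bracket_nonzero[of "Suc (d - i)", where 'a='a]
    by (simp add: carlitz_coeff_def carlitz_D_nonzero carlitz_l_nonzero field_simps)
next
  case False
  then show ?thesis by (cases "i = Suc d") (auto simp: carlitz_coeff_def)
qed

lemma carlitz_eval_add: "carlitz_eval d (x + y) = carlitz_eval d x + carlitz_eval d y"
  by (simp add: carlitz_eval_def power_CARD_power_add distrib_left sum.distrib)

lemma Fract_const_power_CARD: "Fract [:c:] 1 ^ CARD('a) = Fract [:c :: 'a::{field,finite}:] 1"
  by (simp add: Fract_power poly_const_pow power_CARD_field)

lemma Fract_const_power_CARD_power:
  "Fract [:c:] 1 ^ (CARD('a) ^ i) = Fract [:c :: 'a::{field,finite}:] 1"
  by (induction i) (simp_all add: power_mult Fract_const_power_CARD)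

lemma carlitz_eval_const_mult:
  "carlitz_eval d (Fract [:c:] 1 * x) = Fract [:c :: 'a::{field,finite}:] 1 * carlitz_eval d x"
  by (simp add: carlitz_eval_def power_mult_distrib Fract_const_power_CARD_power sum_distrib_left
      mult.left_commute)

text \<open>Writing \<theta>^(q^i) = [i] + \<theta> separates the factor \<theta>. In the remaining
  sum the term i = 0 drops out, and the other coefficients are q-th powers of those of E_d.\<close>

lemma carlitz_eval_theta_mult:
  fixes x :: "'a::{field,finite} poly fract"
  shows "carlitz_eval (Suc d) (theta * x) = theta * carlitz_eval (Suc d) x + carlitz_eval d x ^ CARD('a)"
proof -
  have th: "theta ^ (CARD('a) ^ i) = (bracket i + theta :: 'a poly fract)" for i
    by (simp add: bracket_def)
  have "carlitz_eval (Suc d) (theta * x) = theta * carlitz_eval (Suc d) x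
      + (\<Sum>i\<le>Suc d. bracket i * carlitz_coeff (Suc d) i * x ^ (CARD('a) ^ i))"
    by (simp only: carlitz_eval_def power_mult_distrib th sum_distrib_left sum.distrib[symmetric])
       (simp add: algebra_simps)
  also have "(\<Sum>i\<le>Suc d. bracket i * carlitz_coeff (Suc d) i * x ^ (CARD('a) ^ i))
      = (\<Sum>i\<le>d. bracket (Suc i) * carlitz_coeff (Suc d) (Suc i) * x ^ (CARD('a) ^ Suc i))"
    by (simp only: sum.atMost_Suc_shift) simp
  also have "\<dots> = carlitz_eval d x ^ CARD('a)"
    by (simp only: bracket_carlitz_coeff_Suc carlitz_eval_def power_CARD_sum)
       (simp add: power_mult_distrib mult.commute flip: power_mult)
  finally show ?thesis .
qed

text \<open>The two coefficient recursions combine to [d+1] E_(d+1)(1) = E_d(1)^q - E_d(1), which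
  vanishes because E_d(1) is 0 or 1.\<close>

lemma carlitz_eval_one: "carlitz_eval d (1 :: 'a::{field,finite} poly fract) = (if d = 0 then 1 else 0)"
proof (induction d)
  case 0
  then show ?case by (simp add: carlitz_eval_def carlitz_coeff_0)
next
  case (Suc d)
  have "bracket (Suc d) * carlitz_eval (Suc d) (1 :: 'a poly fract)
      = (\<Sum>i\<le>Suc d. bracket i * carlitz_coeff (Suc d) i
          + (bracket (Suc d) - bracket i) * carlitz_coeff (Suc d) i)"
    by (simp only: carlitz_eval_def sum_distrib_left) (simp add: algebra_simps)
  also have "\<dots> = (\<Sum>i\<le>Suc d. bracket i * carlitz_coeff (Suc d) i) - (\<Sum>i\<le>Suc d. carlitz_coeff d i)"
    by (simp only: bracket_diff_carlitz_coeff) (simp add: sum_subtractf)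
  also have "(\<Sum>i\<le>Suc d. bracket i * carlitz_coeff (Suc d) i) = (carlitz_eval d (1 :: 'a poly fract)) ^ CARD('a)"
    by (simp only: sum.atMost_Suc_shift bracket_carlitz_coeff_Suc) (simp add: carlitz_eval_def power_CARD_sum)
  also have "(\<Sum>i\<le>Suc d. carlitz_coeff d i) = carlitz_eval d (1 :: 'a poly fract)"
    by (simp add: carlitz_eval_def) (simp add: carlitz_coeff_def)
  finally show ?case
    using bracket_nonzero[of "Suc d", where 'a='a] Suc.IH by (auto simp: zero_power split: if_splits)
qed

lemma Fract_pCons: "Fract (pCons c b) 1 = Fract [:c:] 1 + theta * Fract b 1"
  by (simp add: theta_def)

text \<open>Induction along a = c + \<theta> b: at level e + 1 the value at b vanishes for degree
  reasons, and E_e(b)^q is the coefficient of b at \<theta>^e, which Frobenius fixes.\<close>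

lemma carlitz_eval_poly:
  fixes a :: "'a::{field,finite} poly"
  assumes "degree a \<le> d"
  shows "carlitz_eval d (Fract a 1) = Fract [:coeff a d:] 1"
  using assms
proof (induction a arbitrary: d)
  case 0
  then show ?case using carlitz_eval_const_mult[of d 0 "0 :: 'a poly fract"] by (simp add: fract_collapse)
next
  case (pCons c b)
  have const: "carlitz_eval d (Fract [:c:] 1) = (if d = 0 then Fract [:c:] 1 else 0)"
    using carlitz_eval_const_mult[of d c 1] by (simp add: carlitz_eval_one)
  show ?case
  proof (cases "b = 0")
    case True
    then show ?thesis using const by (cases d) (simp_all add: fract_collapse)
  next
    case False
    then obtain e where d: "d = Suc e" "degree b \<le> e"
      using pCons.prems by (cases d) auto
    have "carlitz_eval d (Fract b 1) = 0"
      using pCons.IH[of d] d by (simp add: coeff_eq_0 fract_collapse)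
    moreover have "carlitz_eval e (Fract b 1) ^ CARD('a) = Fract [:coeff b e:] 1"
      using pCons.IH[of e] d by (simp add: Fract_const_power_CARD)
    ultimately show ?thesis
      using const d by (simp add: Fract_pCons[of c b] carlitz_eval_add carlitz_eval_theta_mult)
  qed
qed

section \<open>The product formula for 1 - E_d\<close>

definition monic_polys :: "nat \<Rightarrow> 'a::{field,finite} poly set" where
  "monic_polys d = {a. lead_coeff a = 1 \<and> degree a = d}"

lemma finite_monic_polys: "finite (monic_polys d)"
  by (rule finite_subset[OF _ finite_degree_le[of d]]) (auto simp: monic_polys_def)

lemma card_monic_polys_ge: "CARD('a) ^ d \<le> card (monic_polys d :: 'a::{field,finite} poly set)"
proof -
  have "card {xs :: 'a list. set xs \<subseteq> UNIV \<and> length xs = d} = CARD('a) ^ d"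
    by (rule card_lists_length_eq) simp
  moreover have "card {xs :: 'a list. set xs \<subseteq> UNIV \<and> length xs = d} \<le> card (monic_polys d :: 'a poly set)"
  proof (rule card_inj_on_le[where f = "\<lambda>xs. Poly (xs @ [1])"])
    \<comment> \<open>The appended leading coefficient 1 keeps \<open>Poly\<close> from stripping
      trailing zeros, so a list is recovered from its polynomial.\<close>
    have coeffs: "coeffs (Poly (xs @ [1 :: 'a])) = xs @ [1]" for xs
      by (rule coeffs_Poly[THEN trans]) simp
    show "inj_on (\<lambda>xs. Poly (xs @ [1])) {xs :: 'a list. set xs \<subseteq> UNIV \<and> length xs = d}"
      by (rule inj_onI) (metis coeffs append_same_eq)
    show "(\<lambda>xs. Poly (xs @ [1])) ` {xs :: 'a list. set xs \<subseteq> UNIV \<and> length xs = d} \<subseteq> monic_polys d"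
    proof safe
      fix xs :: "'a list" assume "d = length xs"
      have nz: "Poly (xs @ [1]) \<noteq> 0" using coeffs[of xs] by (metis coeffs_eq_Nil snoc_eq_iff_butlast)
      then have "lead_coeff (Poly (xs @ [1])) = 1"
        using last_coeffs_eq_coeff_degree[OF nz] by (simp add: coeffs)
      moreover have "degree (Poly (xs @ [1])) = length xs"
        by (simp add: degree_eq_length_coeffs coeffs)
      ultimately show "Poly (xs @ [1]) \<in> monic_polys (length xs)" by (simp add: monic_polys_def)
    qed
  qed (rule finite_monic_polys)
  ultimately show ?thesis by simp
qed

definition carlitz_poly :: "nat \<Rightarrow> 'a::{field,finite} poly fract poly" where
  "carlitz_poly d = 1 - (\<Sum>i\<le>d. monom (carlitz_coeff d i) (CARD('a) ^ i))"

lemma poly_carlitz_poly: "poly (carlitz_poly d) x = 1 - carlitz_eval d x"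
  by (simp add: carlitz_poly_def carlitz_eval_def poly_sum poly_monom)

lemma degree_carlitz_poly_le: "degree (carlitz_poly d :: 'a::{field,finite} poly fract poly) \<le> CARD('a) ^ d"
  unfolding carlitz_poly_def
  using CARD_field_pos[where 'a='a]
  by (intro degree_diff_le degree_sum_le order.trans[OF degree_monom_le] power_increasing)
     auto

lemma monic_polys_nonzero: "a \<in> monic_polys d \<Longrightarrow> a \<noteq> 0"
  by (auto simp: monic_polys_def)

text \<open>Both sides vanish at every monic polynomial of degree d and take the value 1 at 0. Their
  difference thus has one root more than its degree permits, the degree of 1 - E_d being at most
  q^d.\<close>

lemma carlitz_poly_eq_prod:
  "carlitz_poly d = (\<Prod>a\<in>monic_polys d. [:1, - inverse (Fract a (1 :: 'a::{field,finite} poly)):])"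
proof -
  let ?M = "monic_polys d :: 'a poly set"
  let ?R = "\<Prod>a\<in>?M. [:1, - inverse (Fract a (1 :: 'a poly)):]"
  let ?p = "carlitz_poly d - ?R"
  have nz: "Fract a 1 \<noteq> (0 :: 'a poly fract)" if "a \<in> ?M" for a
    using monic_polys_nonzero[OF that] by (simp add: Zero_fract_def eq_fract)
  have roots: "insert 0 ((\<lambda>a. Fract a 1) ` ?M) \<subseteq> {x. poly ?p x = 0}"
  proof safe
    have "carlitz_eval d (0 :: 'a poly fract) = 0"
      using carlitz_eval_const_mult[of d 0 "0 :: 'a poly fract"] by (simp add: fract_collapse)
    then show "poly ?p 0 = 0" by (simp add: poly_carlitz_poly poly_prod)
  next
    fix a assume a: "a \<in> ?M"
    then have "carlitz_eval d (Fract a 1) = 1"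
      using carlitz_eval_poly[of a d] by (auto simp: monic_polys_def One_fract_def one_pCons)
    moreover have "poly ?R (Fract a 1) = 0"
      unfolding poly_prod using a nz[OF a] finite_monic_polys
      by (intro prod_zero bexI[of _ a]) (simp_all del: inverse_fract)
    ultimately show "poly ?p (Fract a 1) = 0" by (simp add: poly_carlitz_poly)
  qed
  have "degree ?R \<le> (\<Sum>a\<in>?M. degree [:1, - inverse (Fract a (1 :: 'a poly)):])"
    by (rule degree_prod_sum_le[OF finite_monic_polys, unfolded o_def])
  also have "\<dots> \<le> (\<Sum>a\<in>?M. 1)" by (rule sum_mono) simp
  finally have "degree ?R \<le> card ?M" by simp
  moreover have "degree (carlitz_poly d :: 'a poly fract poly) \<le> card ?M"
    by (rule order.trans[OF degree_carlitz_poly_le card_monic_polys_ge])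
  ultimately have deg: "degree ?p \<le> card ?M" by (intro degree_diff_le) auto
  have "card (insert 0 ((\<lambda>a. Fract a (1 :: 'a poly)) ` ?M)) = Suc (card ?M)"
  proof -
    have "inj_on (\<lambda>a. Fract a (1 :: 'a poly)) ?M" by (rule inj_onI) (simp add: eq_fract)
    moreover have "0 \<notin> (\<lambda>a. Fract a (1 :: 'a poly)) ` ?M" using nz by force
    ultimately show ?thesis by (simp add: card_image finite_monic_polys)
  qed
  then have "?p = 0"
    using card_poly_roots_bound[of ?p] card_mono[OF poly_roots_finite roots] deg by fastforce
  then show ?thesis by simp
qed

section \<open>Power sums expressed through nested sums\<close>

lemma of_nat_CARD_fract: "of_nat CARD('a) = (0 :: 'a::{field,finite} poly fract)"
proof -
  have "of_nat CARD('a) = (0 :: 'a)"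
    using of_nat_choose_CARD_field[where 'a='a and k=1] one_less_CARD_field[where 'a='a] by simp
  then show ?thesis by (simp add: of_nat_fract of_nat_poly fract_collapse)
qed

text \<open>The exponents q^i with i > 0 vanish in K, so only the linear term survives.\<close>

lemma pderiv_carlitz_poly: "pderiv (carlitz_poly d :: 'a::{field,finite} poly fract poly) = [:- inv_l d:]"
proof -
  have "pderiv (monom (carlitz_coeff d i) (CARD('a) ^ i) :: 'a poly fract poly)
      = (if i = 0 then [:inv_l d:] else 0)" for i
    by (cases i) (simp_all add: pderiv_monom carlitz_coeff_0 of_nat_CARD_fract monom_0)
  moreover have "pderiv (sum f A) = (\<Sum>i\<in>A. pderiv (f i))"
    for f :: "nat \<Rightarrow> 'a poly fract poly" and A
    by (induction A rule: infinite_finite_induct) (simp_all add: pderiv_add)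
  ultimately show ?thesis
    by (simp add: carlitz_poly_def pderiv_diff sum.delta)
qed

text \<open>Dividing by 1 - cX is multiplication by the geometric series in cX.\<close>

lemma coeff_of_linear_cofactor:
  fixes R :: "'b::field poly"
  assumes "p = [:1, - c:] * R"
  shows "coeff R n = (\<Sum>k\<le>n. coeff p k * c ^ (n - k))"
proof (induction n)
  case 0
  then show ?case using assms by simp
next
  case (Suc n)
  have "coeff R (Suc n) = coeff p (Suc n) + c * coeff R n"
    using assms by simp
  also have "\<dots> = (\<Sum>k\<le>Suc n. coeff p k * c ^ (Suc n - k))"
    by (simp add: Suc.IH sum_distrib_left Suc_diff_le mult.left_commute)
  finally show ?case .
qed

text \<open>Compare coefficients in the logarithmic derivative of the product formula.\<close>

lemma power_sum_newton:
  "(\<Sum>k\<le>n. coeff (carlitz_poly d) k * power_sum d (Suc (n - k)))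
     = (if n = 0 then inv_l d else (0 :: 'a::{field,finite} poly fract))"
proof -
  let ?M = "monic_polys d :: 'a poly set"
  let ?c = "\<lambda>a. inverse (Fract a (1 :: 'a poly))"
  let ?R = "\<lambda>a. \<Prod>b\<in>?M - {a}. [:1, - ?c b:]"
  have "coeff (?R a) n = (\<Sum>k\<le>n. coeff (carlitz_poly d) k * ?c a ^ (n - k))" if "a \<in> ?M" for a
    by (rule coeff_of_linear_cofactor)
       (simp only: carlitz_poly_eq_prod prod.remove[OF finite_monic_polys that])
  then have "(\<Sum>k\<le>n. coeff (carlitz_poly d) k * power_sum d (Suc (n - k)))
      = (\<Sum>a\<in>?M. ?c a * coeff (?R a) n)"
    unfolding power_sum_def monic_polys_def[symmetric]
    by (simp add: sum_distrib_left sum.swap[of _ ?M] mult_ac)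
  \<comment> \<open>The product rule differentiates the factor of a to minus its inverse and leaves
    the cofactor \<open>?R a\<close>.\<close>
  also have "\<dots> = coeff (- pderiv (carlitz_poly d)) n"
    unfolding carlitz_poly_eq_prod pderiv_prod
    by (simp add: coeff_sum pderiv_pCons sum_negf mult.commute del: inverse_fract minus_fract)
  also have "\<dots> = (if n = 0 then inv_l d else 0)"
    by (simp add: pderiv_carlitz_poly coeff_pCons split: nat.split)
  finally show ?thesis .
qed

text \<open>Up to the constant 1/[i+1], the coefficient i + 1 at level d is the q-th power of the
  coefficient i at level d - 1, so the twist of level functions supplies the induction step.\<close>

lemma carlitz_coeff_in_level_space:
  "(\<lambda>d. carlitz_coeff d i :: 'a::{field,finite} poly fract) \<in> level_space (CARD('a) ^ i)"
proof (induction i)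
  case 0
  have "(\<lambda>d. inv_l d ^ 1 * 1 :: 'a poly fract) \<in> level_space 1"
    by (rule level_space_gen[OF nested_space_one]) simp_all
  then show ?case by (simp add: carlitz_coeff_0)
next
  case (Suc i)
  have "(\<lambda>d. inverse (bracket (Suc i)) * (if d = 0 then 0 else carlitz_coeff (d - 1) i ^ CARD('a)) :: 'a poly fract)
      \<in> level_space (CARD('a) * CARD('a) ^ i)"
    by (intro level_space_scale level_space_frobenius Suc.IH)
  also have "(\<lambda>d. inverse (bracket (Suc i)) * (if d = 0 then 0 else carlitz_coeff (d - 1) i ^ CARD('a)))
      = (\<lambda>d. carlitz_coeff d (Suc i) :: 'a poly fract)"
  proof
    fix d
    show "inverse (bracket (Suc i)) * (if d = 0 then 0 else carlitz_coeff (d - 1) i ^ CARD('a))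
      = (carlitz_coeff d (Suc i) :: 'a poly fract)"
    proof (cases d)
      case 0
      then show ?thesis by (simp add: carlitz_coeff_def)
    next
      case (Suc e)
      then show ?thesis
        using bracket_carlitz_coeff_Suc[of i e, where 'a='a] bracket_nonzero[of "Suc i", where 'a='a]
        by (simp flip: bracket_carlitz_coeff_Suc)
    qed
  qed
  finally show ?case by simp
qed

text \<open>A positive exponent k carries a coefficient only if k = q^j, and then for a single j,
  since powers of q are distinct.\<close>

lemma coeff_carlitz_poly_in_level_space:
  assumes "0 < k"
  shows "(\<lambda>d. - coeff (carlitz_poly d) k :: 'a::{field,finite} poly fract) \<in> level_space k"
proof -
  have eq: "- coeff (carlitz_poly d) k
      = (\<Sum>i\<le>d. if CARD('a) ^ i = k then carlitz_coeff d i else (0 :: 'a poly fract))" for d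
    using assms by (simp add: carlitz_poly_def coeff_sum)
  show ?thesis
  proof (cases "\<exists>j. k = CARD('a) ^ j")
    case True
    then obtain j where j: "k = CARD('a) ^ j" by blast
    have inj: "CARD('a) ^ i = k \<longleftrightarrow> i = j" for i
      using one_less_CARD_field[where 'a='a] by (auto simp: j)
    have "- coeff (carlitz_poly d) k = (carlitz_coeff d j :: 'a poly fract)" for d
      unfolding eq inj by (simp add: carlitz_coeff_def)
    then show ?thesis using carlitz_coeff_in_level_space[of j, where 'a='a] j by simp
  next
    case False
    then have "CARD('a) ^ i \<noteq> k" for i by auto
    then show ?thesis unfolding eq by (simp add: level_space_zero)
  qed
qed
lemma coeff_carlitz_poly_0: "coeff (carlitz_poly d) 0 = 1"
  by (simp add: carlitz_poly_def coeff_sum)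

lemma power_sum_Suc:
  "power_sum d (Suc n) = (if n = 0 then inv_l d else (0 :: 'a::{field,finite} poly fract))
     + (\<Sum>k=1..n. - coeff (carlitz_poly d) k * power_sum d (Suc (n - k)))"
proof -
  have "{..n} = insert 0 {1..n}" by auto
  then show ?thesis
    using power_sum_newton[where 'a='a and n=n and d=d]
    by (auto simp: coeff_carlitz_poly_0 sum_negf eq_diff_eq)
qed

lemma power_sum_1: "power_sum d (Suc 0) = inv_l d"
  using power_sum_Suc[of d 0] by simp

text \<open>Newton's relation has leading coefficient 1 and can be solved for S_d(s); the remaining
  terms are products of level functions of total weight s at the same level d.\<close>

lemma power_sum_in_level_space:
  assumes "0 < s"
  shows "(\<lambda>d. power_sum d s :: 'a::{field,finite} poly fract) \<in> level_space s"
  using assms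
proof (induction s rule: less_induct)
  case (less s)
  then obtain n where s: "s = Suc n" by (cases s) auto
  have "(\<lambda>d. if n = 0 then inv_l d else (0 :: 'a poly fract)) \<in> level_space s"
    using carlitz_coeff_in_level_space[of 0, where 'a='a] s
    by (cases n) (simp_all add: carlitz_coeff_0 level_space_zero)
  moreover have "(\<lambda>d. \<Sum>k=1..n. - coeff (carlitz_poly d) k * power_sum d (Suc (n - k)) :: 'a poly fract)
      \<in> level_space s"
  proof (rule level_space_sum)
    fix k assume k: "k \<in> {1..n}"
    have "(\<lambda>d. - coeff (carlitz_poly d) k * power_sum d (Suc (n - k)) :: 'a poly fract)
        \<in> level_space (k + Suc (n - k))"
      using k s by (intro level_space_mult coeff_carlitz_poly_in_level_space less.IH) auto
    then show "(\<lambda>d. - coeff (carlitz_poly d) k * power_sum d (Suc (n - k)) :: 'a poly fract)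
        \<in> level_space s"
      using k s by simp
  qed
  ultimately show ?case unfolding s power_sum_Suc[of _ n] by (rule level_space_add)
qed

section \<open>Truncated multiple zeta values as combinations of nested sums\<close>

lemma decreasing_below_Suc:
  "decreasing_below n (Suc r) = (\<Union>d<n. (#) d ` decreasing_below d r)"
  by (fastforce simp: decreasing_below_def length_Suc_conv image_iff)

lemma truncated_mzv_Nil: "truncated_mzv n [] = 1"
proof -
  have "decreasing_below n 0 = {[]}" by (auto simp: decreasing_below_def)
  then show ?thesis by (simp add: truncated_mzv_def)
qed

lemma truncated_mzv_Cons:
  "truncated_mzv n (s # ss) = (\<Sum>d<n. power_sum d s * truncated_mzv d ss)"
proof -
  have "truncated_mzv n (s # ss)
      = (\<Sum>d<n. \<Sum>ds\<in>(#) d ` decreasing_below d (length ss).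
          \<Prod>i<Suc (length ss). power_sum (ds ! i) ((s # ss) ! i))"
    unfolding truncated_mzv_def list.size add_Suc_right add_0_right decreasing_below_Suc
    by (rule sum.UNION_disjoint) (auto simp: finite_decreasing_below)
  also have "\<dots> = (\<Sum>d<n. power_sum d s * truncated_mzv d ss)"
    by (simp add: truncated_mzv_def sum.reindex prod.lessThan_Suc_shift sum_distrib_left
        del: prod.lessThan_Suc)
  finally show ?thesis .
qed

lemma truncated_mzv_in_nested_space:
  assumes "ss \<in> indices"
  shows "(\<lambda>n. truncated_mzv n ss :: 'a::{field,finite} poly fract) \<in> nested_space (sum_list ss)"
  using assms
proof (induction ss)
  case Nil
  then show ?case using nested_space_one by (simp add: truncated_mzv_Nil)
next
  case (Cons s ss)
  then have s: "0 < s" "ss \<in> indices" by (auto simp: Cons_in_indices)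
  show ?case
    unfolding truncated_mzv_Cons sum_list.Cons
    by (intro sum_level_space_in_nested_space level_space_mult_nested power_sum_in_level_space s Cons.IH)
qed

subsection \<open>Classes of degree-indexed families in \<open>\<A>\<^sub>K\<close>\<close>

text \<open>Guards against the default value of \<open>residue\<close>: the class map below respects
  sums and products of families that are integral at almost all v.\<close>

definition almost_integral :: "(nat \<Rightarrow> 'a::{field,finite} poly fract) \<Rightarrow> bool" where
  "almost_integral f \<longleftrightarrow> finite {v \<in> places. \<not> (\<exists>c. reduces_to v (f (degree v)) c)}"

definition AK_of :: "(nat \<Rightarrow> 'a::{field,finite} poly fract) \<Rightarrow> 'a AK" where
  "AK_of f = abs_AK (\<lambda>v. residue v (f (degree v)))"

lemma fmzv_eq_AK_of: "fmzv ss = AK_of (\<lambda>n. truncated_mzv n ss)"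
  by (simp add: fmzv_def AK_of_def)

lemma of_K_eq_AK_of: "of_K c = AK_of (\<lambda>n. c)"
  by (simp add: of_K_def AK_of_def)

lemma almost_integral_const: "almost_integral (\<lambda>n. c)"
  unfolding almost_integral_def by (rule finite_not_integral)

lemma almost_integral_add:
  assumes "almost_integral f" "almost_integral g"
  shows "almost_integral (\<lambda>n. f n + g n)"
  using assms unfolding almost_integral_def
  by (rule finite_subset[OF _ finite_UnI, rotated]) (auto intro: reduces_to_add)

lemma almost_integral_mult:
  assumes "almost_integral f" "almost_integral g"
  shows "almost_integral (\<lambda>n. f n * g n)"
  using assms unfolding almost_integral_def
  by (rule finite_subset[OF _ finite_UnI, rotated]) (auto intro: reduces_to_mult)

lemma AK_of_add:
  assumes "almost_integral f" "almost_integral g"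
  shows "AK_of (\<lambda>n. f n + g n) = AK_of f + AK_of g"
proof -
  let ?E = "{v \<in> places. \<not> (\<exists>c. reduces_to v (f (degree v)) c)}
    \<union> {v \<in> places. \<not> (\<exists>c. reduces_to v (g (degree v)) c)}"
  have "AK_rel (\<lambda>v. residue v (f (degree v) + g (degree v)))
      (\<lambda>v. residue v (f (degree v)) + residue v (g (degree v)))"
    by (rule AK_rel_by[of ?E])
       (use assms in \<open>auto simp: almost_integral_def intro!: residue_cong reduces_to_add
          intro: reduces_to_residue\<close>)
  then show ?thesis by (simp add: AK_of_def plus_AK.abs_eq AK.abs_eq_iff)
qed

lemma AK_of_mult:
  assumes "almost_integral f" "almost_integral g"
  shows "AK_of (\<lambda>n. f n * g n) = AK_of f * AK_of g"
proof -
  let ?E = "{v \<in> places. \<not> (\<exists>c. reduces_to v (f (degree v)) c)}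
    \<union> {v \<in> places. \<not> (\<exists>c. reduces_to v (g (degree v)) c)}"
  have "AK_rel (\<lambda>v. residue v (f (degree v) * g (degree v)))
      (\<lambda>v. residue v (f (degree v)) * residue v (g (degree v)))"
    by (rule AK_rel_by[of ?E])
       (use assms in \<open>auto simp: almost_integral_def intro!: residue_cong reduces_to_mult
          intro: reduces_to_residue\<close>)
  then show ?thesis by (simp add: AK_of_def times_AK.abs_eq AK.abs_eq_iff)
qed

lemma AK_of_scale:
  assumes "almost_integral f"
  shows "AK_of (\<lambda>n. c * f n) = scale_AK c (AK_of f)"
  by (simp add: AK_of_mult almost_integral_const assms scale_AK_def of_K_eq_AK_of)

lemma AK_of_zero: "AK_of (\<lambda>n. 0) = 0"
  using of_K_poly[of 0] by (simp add: of_K_eq_AK_of zero_AK_def fract_collapse)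

section \<open>Integrality at a place\<close>

lemma not_dvd_monic:
  fixes v a :: "'a::{field,finite} poly"
  assumes "v \<in> places" "lead_coeff a = 1" "degree a \<le> degree v" "a \<noteq> v"
  shows "\<not> v dvd a"
proof
  assume "v dvd a"
  then obtain k where k: "a = v * k" by auto
  have nz: "a \<noteq> 0" using assms(2) by auto
  then have "v \<noteq> 0" "k \<noteq> 0" using k by auto
  then have "degree k = 0" using k assms(3) by (simp add: degree_mult_eq)
  then obtain c where c: "k = [:c:]" by (rule degree_eq_zeroE)
  have "lead_coeff a = lead_coeff v * lead_coeff k" unfolding k by (rule lead_coeff_mult)
  then have "c = 1" using assms(1,2) c by (simp add: places_def)
  then show False using k c assms(4) by simp
qed

lemma integral_inverse_Fract:
  assumes "v \<in> places" "\<not> v dvd a"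
  shows "\<exists>c. reduces_to v (inverse (Fract a 1)) c"
  using reduces_to_Fract[OF assms] by simp

text \<open>Both the integrality of 1/l_d for d < deg v and its pole at d = deg v are read off from
  this sum.\<close>

lemma inv_l_eq_sum: "inv_l d = (\<Sum>a\<in>monic_polys d. inverse (Fract a 1))"
  by (simp add: power_sum_def monic_polys_def flip: power_sum_1)

lemma integral_inv_l:
  assumes "v \<in> places" "d < degree v"
  shows "\<exists>c. reduces_to v (inv_l d) c"
  unfolding inv_l_eq_sum
  by (intro integral_sum[OF assms(1)] integral_inverse_Fract not_dvd_monic assms(1))
     (use assms(2) in \<open>auto simp: monic_polys_def\<close>)

lemma integral_power:
  assumes "v \<in> places" "\<exists>c. reduces_to v x c"
  shows "\<exists>c. reduces_to v (x ^ k) c"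
  using integral_prod[OF assms(1), of "{..<k}" "\<lambda>_. x"] assms(2) by simp

lemma integral_mult:
  assumes "v \<in> places" "\<exists>c. reduces_to v x c" "\<exists>c. reduces_to v y c"
  shows "\<exists>c. reduces_to v (x * y) c"
  using assms reduces_to_mult by blast

lemma integral_nested_sum:
  assumes v: "v \<in> places" and "n \<le> degree v"
  shows "\<exists>c. reduces_to v (nested_sum u n) c"
  using assms(2)
proof (induction u arbitrary: n)
  case Nil
  then show ?case using reduces_to_poly[OF v, of 1] by (auto simp: One_fract_def)
next
  case (Cons s u)
  show ?case
    unfolding nested_sum.simps
    by (intro integral_sum[OF v] integral_mult[OF v] integral_power[OF v] integral_inv_l[OF v] Cons.IH)
       (use Cons.prems in auto)
qed

text \<open>
  Among the monic polynomials of degree \<open>deg v\<close> only \<open>v\<close> itself is divisible by \<open>v\<close>, so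
  \<open>1 / l\<^sub>n = S\<^sub>n(1)\<close> has a simple pole at \<open>v\<close> for \<open>n = deg v\<close>.
\<close>

lemma carlitz_l_reduces_to_0:
  assumes v: "v \<in> places"
  shows "reduces_to v (carlitz_l (degree v)) 0"
proof -
  let ?n = "degree v"
  let ?y = "\<Sum>a\<in>monic_polys ?n - {v}. inverse (Fract a 1)"
  have vM: "v \<in> monic_polys ?n" using v by (simp add: places_def monic_polys_def)
  have vnz: "v \<noteq> 0" using monic_polys_nonzero[OF vM] .
  have "\<exists>c. reduces_to v ?y c"
    by (intro integral_sum[OF v] integral_inverse_Fract not_dvd_monic v)
       (auto simp: monic_polys_def)
  then obtain a b where ab: "?y = Fract a b" "\<not> v dvd b"
    by (auto simp: reduces_to_def)
  have nd: "\<not> v dvd b + v * a" using ab(2) by (simp add: dvd_add_left_iff)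
  have nz: "b \<noteq> 0" "b + v * a \<noteq> 0" using ab(2) nd by auto
  have "inv_l ?n = inverse (Fract v 1) + ?y"
    unfolding inv_l_eq_sum by (rule sum.remove[OF finite_monic_polys vM])
  also have "\<dots> = Fract (b + v * a) (v * b)" using ab(1) vnz nz by (simp add: mult.commute)
  finally have "carlitz_l ?n = inverse (Fract (b + v * a) (v * b))"
    by (metis inv_l_def inverse_inverse_eq)
  then have "carlitz_l ?n = Fract (v * b) (b + v * a)" by simp
  then show ?thesis unfolding reduces_to_def using nd by (metis diff_0_right dvd_triv_left mult_zero_right)
qed

section \<open>The values \<lambda> in A_K and their two families of relations\<close>

lemma degree_place_pos: "v \<in> places \<Longrightarrow> 0 < degree v"
  by (auto simp: places_def irreducible_def is_unit_iff_degree)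

definition fmzl :: "nat list \<Rightarrow> 'a::{field,finite} AK" where
  "fmzl u = AK_of (nested_sum u)"

lemma almost_integral_nested_sum: "almost_integral (nested_sum u)"
  unfolding almost_integral_def
  by (rule finite_subset[of _ "{}"]) (use integral_nested_sum in blast)+

lemma fmzl_CARD_minus_1: "fmzl [CARD('a) - 1] = (0 :: 'a::{field,finite} AK)"
proof -
  let ?q = "CARD('a)"
  let ?x = "nested_sum [?q - 1] :: nat \<Rightarrow> 'a poly fract"
  let ?D = "bracket 1 :: 'a poly fract"
  have "v dvd residue v (?x (degree v)) - 0"
    \<comment> \<open>The condition on 1/[1] excludes only the finitely many v dividing \<theta>^q -
      \<theta>, which A_K ignores.\<close>
    if v: "v \<in> places" and D: "\<exists>c. reduces_to v (inverse (- ?D)) c" for v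
  proof (rule residue_cong[OF v])
    obtain n where n: "degree v = Suc n" using degree_place_pos[OF v] by (cases "degree v") auto
    have "\<exists>c. reduces_to v (inverse (- ?D) * inv_l n ^ ?q) c"
      using n by (intro integral_mult integral_power integral_inv_l v D) simp
    then obtain c where c: "reduces_to v (inverse (- ?D) * inv_l n ^ ?q) c" by blast
    \<comment> \<open>With deg v = n + 1, \<open>inv_l_power_CARD\<close> is solved for the sum. The
      last factor reduces to 0 and the others are integral at v.\<close>
    have "inverse (- ?D) * inv_l n ^ ?q * carlitz_l (degree v) = ?x (degree v)"
      using bracket_nonzero[of 1, where 'a='a] carlitz_l_nonzero[of "Suc n", where 'a='a]
      unfolding inv_l_power_CARD n by (simp add: inv_l_def del: nested_sum.simps)
    then show "reduces_to v (?x (degree v)) 0"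
      using reduces_to_mult[OF v c carlitz_l_reduces_to_0[OF v]] by simp
  qed
  then have "AK_rel (\<lambda>v. residue v (?x (degree v))) (\<lambda>_. 0)"
    by (intro AK_rel_by[OF finite_not_integral[of "inverse (- ?D)"]]) blast
  then show ?thesis by (simp add: fmzl_def AK_of_def zero_AK_def AK.abs_eq_iff)
qed

lemma almost_integral_sum_list:
  "almost_integral (\<lambda>n. \<Sum>x\<leftarrow>xs. nested_sum x n)"
  by (induction xs) (simp_all add: almost_integral_const almost_integral_add almost_integral_nested_sum)

lemma sum_list_fmzl: "(\<Sum>x\<leftarrow>xs. fmzl x) = AK_of (\<lambda>n. \<Sum>x\<leftarrow>xs. nested_sum x n)"
  by (induction xs)
     (simp_all add: AK_of_zero fmzl_def AK_of_add almost_integral_nested_sum almost_integral_sum_list)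

text \<open>Multiply \<lambda>(q-1) = 0 by \<lambda>(u) and expand the product.\<close>

lemma sum_list_fmzl_insert_letter:
  "(\<Sum>x\<leftarrow>insert_letter (CARD('a) - 1) u. fmzl x) = (0 :: 'a::{field,finite} AK)"
proof -
  have "(\<Sum>x\<leftarrow>insert_letter (CARD('a) - 1) u. fmzl x) = fmzl [CARD('a) - 1] * (fmzl u :: 'a AK)"
    unfolding sum_list_fmzl nested_sum_insert_letter[symmetric]
    by (simp only: AK_of_mult almost_integral_nested_sum fmzl_def)
  then show ?thesis by (simp only: fmzl_CARD_minus_1 mult_zero_left)
qed

primrec insert_front :: "nat \<Rightarrow> nat list \<Rightarrow> nat list list" where
  "insert_front c [] = [[c]]"
| "insert_front c (s # u) = [c # s # u, (c + s) # u]"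

text \<open>Truncation at \<open>Suc d\<close> allows the first index of u to equal d; that diagonal
  part merges c with the first letter.\<close>

lemma sum_list_insert_front:
  "(\<Sum>x\<leftarrow>insert_front c u. nested_sum x n) = (\<Sum>d<n. inv_l d ^ c * nested_sum u (Suc d))"
  by (cases u) (simp_all add: distrib_left sum.distrib power_add mult.assoc)

text \<open>
  The letter \<open>q\<close> is traded for the letters \<open>1\<close> and \<open>q - 1\<close> one level higher; the shift of the
  level makes the letter \<open>t\<close> absorb the new letter \<open>1\<close>.
\<close>

definition shift_words :: "nat \<Rightarrow> nat \<Rightarrow> nat list \<Rightarrow> nat list list" where
  "shift_words q t u =
     map (\<lambda>x. t # 1 # x) (insert_letter (q - 1) u) @ map (\<lambda>x. (t + 1) # x) (insert_letter (q - 1) u)"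

lemma sum_list_insert_front_CARD:
  "(\<Sum>x\<leftarrow>insert_front CARD('a) u. nested_sum (t # x) n)
     = - bracket 1 * (\<Sum>x\<leftarrow>shift_words CARD('a) t u. nested_sum x n :: 'a::{field,finite} poly fract)"
proof -
  let ?q = "CARD('a)"
  let ?ws = "insert_letter (?q - 1) u"
  define Y :: "nat \<Rightarrow> 'a poly fract" where "Y d = (\<Sum>x\<leftarrow>?ws. nested_sum x d)" for d
  have Y: "Y d = nested_sum [?q - 1] d * nested_sum u d" for d
    unfolding Y_def by (rule nested_sum_insert_letter[symmetric])
  have "(\<Sum>x\<leftarrow>insert_front ?q u. nested_sum x n) = - bracket 1 * ((\<Sum>d<n. inv_l d * Y d) + inv_l n * Y n)" for n
  proof -
    have "(\<Sum>x\<leftarrow>insert_front ?q u. nested_sum x n) = (\<Sum>d<n. - bracket 1 * (inv_l (Suc d) * Y (Suc d)))"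
      unfolding sum_list_insert_front inv_l_power_CARD Y by (simp only: mult_ac)
    \<comment> \<open>The added index 0 contributes nothing, as \<open>Y 0\<close> contains the
      empty sum \<open>nested_sum [?q - 1] 0\<close>. The top index d = n gives the term outside the
      strict sum.\<close>
    also have "\<dots> = - bracket 1 * (\<Sum>d<Suc n. inv_l d * Y d)"
      by (simp only: sum.lessThan_Suc_shift sum_distrib_left) (simp add: Y sum_distrib_left)
    finally show ?thesis by simp
  qed
  then have "(\<Sum>x\<leftarrow>insert_front ?q u. nested_sum (t # x) n)
      = - bracket 1 * ((\<Sum>m<n. inv_l m ^ t * (\<Sum>d<m. inv_l d ^ 1 * Y d)) + (\<Sum>d<n. inv_l d ^ (t + 1) * Y d))"
    by (simp only: sum_list_nested_sum_Cons)
       (simp add: sum_distrib_left sum_distrib_right sum.distrib[symmetric] algebra_simps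
         sum_negf[symmetric])
  also have "(\<Sum>d<n. inv_l d ^ (t + 1) * Y d) = (\<Sum>x\<leftarrow>?ws. nested_sum ((t + 1) # x) n)"
    unfolding Y_def by (rule sum_list_nested_sum_Cons[symmetric])
  also have "(\<Sum>m<n. inv_l m ^ t * (\<Sum>d<m. inv_l d ^ 1 * Y d)) = (\<Sum>x\<leftarrow>?ws. nested_sum (t # 1 # x) n)"
    using sum_list_nested_sum_Cons[where s=t and xs="map ((#) 1) ?ws" and n=n and 'a='a]
    by (simp only: Y_def sum_list_nested_sum_Cons[symmetric] list.map_comp o_def)
  finally show ?thesis by (simp add: shift_words_def o_def)
qed

text \<open>The relation is assumed at every truncation because a prefix evaluates it at all smaller
  levels.\<close>

lemma sum_list_nested_sum_append:
  assumes "\<And>n. (\<Sum>x\<leftarrow>xs. nested_sum x n) = c * (\<Sum>x\<leftarrow>ys. nested_sum x n :: 'a::{field,finite} poly fract)"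
  shows "(\<Sum>x\<leftarrow>xs. nested_sum (p @ x) n) = c * (\<Sum>x\<leftarrow>ys. nested_sum (p @ x) n :: 'a poly fract)"
proof (induction p arbitrary: n)
  case Nil
  then show ?case by (simp add: assms)
next
  case (Cons s p)
  have "(\<Sum>x\<leftarrow>zs. nested_sum ((s # p) @ x) n :: 'a poly fract)
      = (\<Sum>d<n. inv_l d ^ s * (\<Sum>x\<leftarrow>zs. nested_sum (p @ x) d))" for zs
    using sum_list_nested_sum_Cons[where s=s and xs="map ((@) p) zs" and n=n and 'a='a] by (simp add: o_def)
  then show ?case by (simp only: Cons.IH sum_distrib_left mult.left_commute)
qed

lemma sum_list_fmzl_insert_front:
  "(\<Sum>x\<leftarrow>insert_front CARD('a) u. fmzl (p @ t # x))
     = scale_AK (- bracket 1) (\<Sum>x\<leftarrow>shift_words CARD('a) t u. fmzl (p @ x) :: 'a::{field,finite} AK)"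
proof -
  let ?xs = "map ((#) t) (insert_front CARD('a) u)" and ?ys = "shift_words CARD('a) t u"
  have "(\<Sum>x\<leftarrow>?xs. nested_sum (p @ x) n)
      = - bracket 1 * (\<Sum>x\<leftarrow>?ys. nested_sum (p @ x) n :: 'a poly fract)" for n
    by (rule sum_list_nested_sum_append) (simp only: list.map_comp o_def sum_list_insert_front_CARD)
  then have "AK_of (\<lambda>n. \<Sum>x\<leftarrow>map ((@) p) ?xs. nested_sum x n)
      = scale_AK (- bracket 1) (AK_of (\<lambda>n. \<Sum>x\<leftarrow>map ((@) p) ?ys. nested_sum x n :: 'a poly fract))"
    by (simp only: list.map_comp o_def AK_of_scale[symmetric] 
      almost_integral_sum_list[of "map ((@) p) ?ys", unfolded list.map_comp o_def])
  then have "(\<Sum>x\<leftarrow>map ((@) p) ?xs. fmzl x)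
      = scale_AK (- bracket 1) (\<Sum>x\<leftarrow>map ((@) p) ?ys. fmzl x :: 'a AK)"
    unfolding sum_list_fmzl .
  then show ?thesis by (simp only: list.map_comp o_def)
qed

subsection \<open>Spanning words\<close>

text \<open>\<open>M\<close> plays the role of the maximal ideal of a local ring.\<close>

lemma (in vector_space) nakayama_subspace:
  assumes M_1: "1 \<notin> M"
    and M_closed: "\<And>x y z w. x \<in> M \<Longrightarrow> y \<in> M \<Longrightarrow> z \<in> M \<Longrightarrow> w \<in> M \<Longrightarrow> x + y * z / (1 - w) \<in> M"
    and S: "subspace S"
    and "finite U"
    and "\<And>u. u \<in> U \<Longrightarrow> \<exists>m. (\<forall>u'. m u' \<in> M) \<and> f u - (\<Sum>u'\<in>U. m u' *s f u') \<in> S"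
    and "u \<in> U"
  shows "f u \<in> S"
  using assms(4-)
proof (induction U arbitrary: u rule: finite_induct)
  case (insert a U)
  obtain m where m: "\<And>u. m u \<in> M" and ma: "f a - (\<Sum>u\<in>insert a U. m u *s f u) \<in> S"
    using insert.prems(1)[of a] by auto
  \<comment> \<open>Since 1 is not in M, the coefficient 1 - m a is invertible and the congruence
    for \<open>f a\<close> can be solved for it.\<close>
  let ?c = "1 / (1 - m a)"
  have c: "?c * (1 - m a) = 1" using m[of a] M_1 by auto
  have "?c *s (f a - (\<Sum>u\<in>insert a U. m u *s f u)) \<in> S"
    by (rule subspace_scale[OF S ma])
  also have "f a - (\<Sum>u\<in>insert a U. m u *s f u) = (1 - m a) *s f a - (\<Sum>u\<in>U. m u *s f u)"
    using insert.hyps by (simp add: scale_left_diff_distrib)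
  also have "?c *s \<dots> = f a - (\<Sum>u\<in>U. (?c * m u) *s f u)"
    by (simp only: scale_right_diff_distrib scale_scale c scale_one scale_sum_right)
  finally have a: "f a - (\<Sum>u\<in>U. (?c * m u) *s f u) \<in> S" .
  have U: "f u \<in> S" if "u \<in> U" for u
  proof (rule insert.IH[OF _ that])
    fix u assume "u \<in> U"
    then obtain k where k: "\<And>u. k u \<in> M" and ku: "f u - (\<Sum>u\<in>insert a U. k u *s f u) \<in> S"
      using insert.prems(1)[of u] by auto
    \<comment> \<open>The coefficients after eliminating \<open>f a\<close>; the closure hypothesis
      on M has exactly this form.\<close>
    let ?l = "\<lambda>u. k u + k a * m u / (1 - m a)"
    have "(f u - (\<Sum>u\<in>insert a U. k u *s f u)) + k a *s (f a - (\<Sum>u\<in>U. (?c * m u) *s f u)) \<in> S"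
      by (rule subspace_add[OF S ku subspace_scale[OF S a]])
    also have "(f u - (\<Sum>u\<in>insert a U. k u *s f u)) + k a *s (f a - (\<Sum>u\<in>U. (?c * m u) *s f u))
        = f u - (\<Sum>u\<in>U. ?l u *s f u)"
      using insert.hyps
      by (simp add: scale_right_diff_distrib scale_sum_right scale_left_distrib sum.distrib)
    finally show "\<exists>m. (\<forall>u'. m u' \<in> M) \<and> f u - (\<Sum>u'\<in>U. m u' *s f u') \<in> S"
      using M_closed[OF k k m m] by (intro exI[of _ ?l]) auto
  qed
  have "(f a - (\<Sum>u\<in>U. (?c * m u) *s f u)) + (\<Sum>u\<in>U. (?c * m u) *s f u) \<in> S"
    by (intro subspace_add[OF S a] subspace_sum[OF S] subspace_scale[OF S] U)
  then have "f a \<in> S" by simp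
  then show ?case using insert.prems(2) U by auto
qed simp

section \<open>The maximal ideal of \<F>_q[\<theta>] localised at \<theta>\<close>

definition vanishing_at_0 :: "'a::{field,finite} poly fract set" where
  "vanishing_at_0 = {Fract a b | a b. poly a 0 = 0 \<and> poly b 0 \<noteq> 0}"

lemma one_notin_vanishing_at_0: "1 \<notin> vanishing_at_0"
proof
  assume "(1 :: 'a poly fract) \<in> vanishing_at_0"
  then obtain a b :: "'a poly" where ab: "Fract 1 1 = Fract a b" "poly a 0 = 0" "poly b 0 \<noteq> 0"
    by (auto simp: vanishing_at_0_def One_fract_def)
  then have "b \<noteq> 0" by auto
  then have "a = b" using ab(1) by (simp add: eq_fract)
  then show False using ab by simp
qed

lemma zero_in_vanishing_at_0: "0 \<in> vanishing_at_0"
  unfolding vanishing_at_0_def Zero_fract_def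
  by (intro CollectI exI[of _ 0] exI[of _ 1]) simp

lemma vanishing_at_0_add:
  assumes "x \<in> vanishing_at_0" "y \<in> vanishing_at_0"
  shows "x + y \<in> vanishing_at_0"
proof -
  obtain a b c d where *: "x = Fract a b" "poly a 0 = 0" "poly b 0 \<noteq> 0"
    "y = Fract c d" "poly c 0 = 0" "poly d 0 \<noteq> 0"
    using assms by (auto simp: vanishing_at_0_def)
  then have "b \<noteq> 0" "d \<noteq> 0" by auto
  then have "x + y = Fract (a * d + c * b) (b * d)" using * by simp
  then show ?thesis unfolding vanishing_at_0_def using * by fastforce
qed

lemma vanishing_at_0_mult_divide:
  assumes "x \<in> vanishing_at_0" "y \<in> vanishing_at_0" "z \<in> vanishing_at_0"
  shows "x * y / (1 - z) \<in> vanishing_at_0"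
proof -
  obtain a b c d e f where *: "x = Fract a b" "poly a 0 = 0" "poly b 0 \<noteq> 0"
    "y = Fract c d" "poly c 0 = 0" "poly d 0 \<noteq> 0" "z = Fract e f" "poly e 0 = 0" "poly f 0 \<noteq> 0"
    using assms unfolding vanishing_at_0_def by blast
  then have "f \<noteq> 0" by auto
  then have "x * y / (1 - z) = Fract (a * c * f) (b * d * (f - e))" using * by (simp add: One_fract_def)
  then show ?thesis unfolding vanishing_at_0_def using * by fastforce
qed

lemma minus_bracket_vanishing_at_0: "- bracket 1 \<in> (vanishing_at_0 :: 'a::{field,finite} poly fract set)"
proof -
  have "- bracket 1 = Fract ([:0, 1:] - [:0, 1 :: 'a:] ^ CARD('a)) 1"
    by (simp add: bracket_def theta_def Fract_power)
  moreover have "poly ([:0, 1:] - [:0, 1 :: 'a:] ^ CARD('a)) 0 = 0"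
    by (simp add: zero_power)
  ultimately show ?thesis unfolding vanishing_at_0_def by force
qed

section \<open>Spanning words and congruences modulo the maximal ideal\<close>

definition weight_words :: "nat \<Rightarrow> nat list set" where
  "weight_words w = {u \<in> indices. sum_list u = w}"

definition tail_words :: "nat \<Rightarrow> nat list set" where
  "tail_words q = {u \<in> indices. (\<forall>s\<in>set u. s \<le> q) \<and> (u \<noteq> [] \<longrightarrow> last u < q)}"

text \<open>The word \<open>[q - 1]\<close> is removed because its value is 0. The empty word
  accounts for weight 0.\<close>

definition basis_words :: "nat \<Rightarrow> nat list set" where
  "basis_words q = insert [] {t # u | t u. 0 < t \<and> t < q \<and> u \<in> tail_words q} - {[q - 1]}"

lemma insert_letter_weight_words:
  assumes "0 < c" "u \<in> weight_words w" "x \<in> set (insert_letter c u)"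
  shows "x \<in> weight_words (c + w)"
  using assms(2,3)
proof (induction u arbitrary: w x)
  case Nil
  then show ?case using assms(1) by (auto simp: weight_words_def indices_def)
next
  case (Cons s u)
  then have s: "0 < s" "u \<in> weight_words (w - s)" "s \<le> w"
    by (auto simp: weight_words_def Cons_in_indices)
  have "s # y \<in> weight_words (c + w)" if "y \<in> set (insert_letter c u)" for y
    using Cons.IH[OF s(2) that] s by (auto simp: weight_words_def Cons_in_indices)
  moreover have "c # s # u \<in> weight_words (c + w)" "(c + s) # u \<in> weight_words (c + w)"
    using Cons.prems(1) assms(1) by (auto simp: weight_words_def Cons_in_indices)
  ultimately show ?case using Cons.prems(2) by auto
qed

text \<open>Congruence to S modulo the maximal ideal, in the form Nakayama's lemma expects. Sums and
  differences stay inside, whereas a scalar with a pole at \<theta> = 0 need not preserve the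
  condition.\<close>

definition near_space :: "nat \<Rightarrow> 'a::{field,finite} AK set \<Rightarrow> 'a AK set" where
  "near_space w S = {x. \<exists>m. (\<forall>u. m u \<in> vanishing_at_0) \<and>
     x - (\<Sum>u\<in>weight_words w. scale_AK (m u) (fmzl u)) \<in> S}"

lemma near_space_base:
  assumes "x \<in> S"
  shows "x \<in> near_space w S"
  unfolding near_space_def
  by (intro CollectI exI[of _ "\<lambda>_. 0"]) (simp add: assms zero_in_vanishing_at_0)

lemma near_space_add:
  assumes "AK.subspace S" "x \<in> near_space w S" "y \<in> near_space w S"
  shows "x + y \<in> near_space w S"
proof -
  obtain m k where m: "\<And>u. m u \<in> vanishing_at_0" "x - (\<Sum>u\<in>weight_words w. scale_AK (m u) (fmzl u)) \<in> S"
    and k: "\<And>u. k u \<in> vanishing_at_0" "y - (\<Sum>u\<in>weight_words w. scale_AK (k u) (fmzl u)) \<in> S"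
    using assms(2,3) unfolding near_space_def by blast
  have "(x - (\<Sum>u\<in>weight_words w. scale_AK (m u) (fmzl u)))
      + (y - (\<Sum>u\<in>weight_words w. scale_AK (k u) (fmzl u))) \<in> S"
    by (rule AK.subspace_add[OF assms(1) m(2) k(2)])
  then have "x + y - (\<Sum>u\<in>weight_words w. scale_AK (m u + k u) (fmzl u)) \<in> S"
    by (simp add: AK.scale_left_distrib sum.distrib algebra_simps)
  then show ?thesis
    unfolding near_space_def using vanishing_at_0_add[OF m(1) k(1)]
    by (intro CollectI exI[of _ "\<lambda>u. m u + k u"]) simp
qed

lemma finite_weight_words: "finite (weight_words w)"
  unfolding weight_words_def using finite_indices .

lemma scale_fmzl_in_near_space:
  assumes "AK.subspace S" "c \<in> vanishing_at_0" "u \<in> weight_words w"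
  shows "scale_AK c (fmzl u) \<in> near_space w S"
proof -
  have "(\<Sum>u'\<in>weight_words w. scale_AK (if u' = u then c else 0) (fmzl u')) = scale_AK c (fmzl u)"
    using assms(3) finite_weight_words[of w]
    by (simp add: if_distrib[of "\<lambda>c. scale_AK c _"] sum.delta cong: if_cong)
  then show ?thesis
    unfolding near_space_def using assms AK.subspace_0[OF assms(1)]
    by (intro CollectI exI[of _ "\<lambda>u'. if u' = u then c else 0"]) (auto simp: zero_in_vanishing_at_0)
qed

lemma scale_sum_list_fmzl_in_near_space:
  assumes "AK.subspace S" "c \<in> vanishing_at_0" "\<And>x. x \<in> set xs \<Longrightarrow> g x \<in> weight_words w"
  shows "scale_AK c (\<Sum>x\<leftarrow>xs. fmzl (g x)) \<in> near_space w S"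
  using assms(3)
  by (induction xs)
     (simp_all add: near_space_base AK.subspace_0 assms(1) AK.scale_right_distrib near_space_add
        scale_fmzl_in_near_space assms(2))

lemma near_space_diff:
  assumes "AK.subspace S" "x \<in> near_space w S" "y \<in> near_space w S"
  shows "x - y \<in> near_space w S"
proof -
  obtain m where m: "\<And>u. m u \<in> vanishing_at_0" "y - (\<Sum>u\<in>weight_words w. scale_AK (m u) (fmzl u)) \<in> S"
    using assms(3) unfolding near_space_def by blast
  have "- m u \<in> vanishing_at_0" for u
  proof -
    obtain a b where "m u = Fract a b" "poly a 0 = 0" "poly b 0 \<noteq> 0"
      using m(1)[of u] by (auto simp: vanishing_at_0_def)
    then have "- m u = Fract (- a) b" "poly (- a) 0 = 0" "poly b 0 \<noteq> 0" by simp_all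
    then show ?thesis unfolding vanishing_at_0_def by blast
  qed
  moreover have "- y - (\<Sum>u\<in>weight_words w. scale_AK (- m u) (fmzl u)) \<in> S"
    using AK.subspace_neg[OF assms(1) m(2)] by (simp add: sum_negf)
  ultimately have "- y \<in> near_space w S"
    unfolding near_space_def by (intro CollectI exI[of _ "\<lambda>u. - m u"]) simp
  then show ?thesis using near_space_add[OF assms(1,2)] by fastforce
qed

lemma near_space_sum_list:
  assumes "AK.subspace S" "\<And>x. x \<in> set xs \<Longrightarrow> g x \<in> near_space w S"
  shows "(\<Sum>x\<leftarrow>xs. g x) \<in> near_space w S"
  using assms(2)
  by (induction xs) (simp_all add: near_space_base AK.subspace_0 assms(1) near_space_add)

lemma append_in_weight_words:
  "u \<in> weight_words m \<Longrightarrow> v \<in> weight_words k \<Longrightarrow> u @ v \<in> weight_words (m + k)"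
  by (simp add: weight_words_def append_in_indices)

lemma Cons_in_weight_words:
  "0 < t \<Longrightarrow> u \<in> weight_words m \<Longrightarrow> t # u \<in> weight_words (t + m)"
  by (simp add: weight_words_def Cons_in_indices)

lemma shift_words_weight_words:
  assumes "1 < q" "0 < t" "u \<in> weight_words m" "x \<in> set (shift_words q t u)"
  shows "x \<in> weight_words (t + q + m)"
proof -
  obtain y where y: "y \<in> set (insert_letter (q - 1) u)" and x: "x = t # 1 # y \<or> x = (t + 1) # y"
    using assms(4) by (auto simp: shift_words_def)
  have "y \<in> weight_words (q - 1 + m)"
    using insert_letter_weight_words[OF _ assms(3) y] assms(1) by simp
  then show ?thesis
    using x assms(1,2) by (auto simp: weight_words_def Cons_in_indices)
qed

text \<open>The other side of the relation carries the factor -[1], which vanishes at \<theta> = 0,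
  and has the same weight. The prefix must be nonempty since its last letter t absorbs the shift of
  the level.\<close>

lemma insert_front_near_space:
  fixes S :: "'a::{field,finite} AK set"
  assumes S: "AK.subspace S" and r: "r \<noteq> []" "r \<in> weight_words k" and u: "u \<in> weight_words m"
    and w: "w = k + CARD('a) + m"
  shows "(\<Sum>x\<leftarrow>insert_front CARD('a) u. fmzl (r @ x)) \<in> near_space w S"
proof -
  obtain p t where pt: "r = p @ [t]" using r(1) by (metis rev_exhaust)
  have t: "0 < t" "p \<in> weight_words (k - t)" "t \<le> k"
    using r(2) by (auto simp: pt weight_words_def append_in_indices Cons_in_indices)
  have "scale_AK (- bracket 1) (\<Sum>x\<leftarrow>shift_words CARD('a) t u. fmzl (p @ x)) \<in> near_space w S"
  proof (rule scale_sum_list_fmzl_in_near_space[OF S minus_bracket_vanishing_at_0])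
    fix x assume "x \<in> set (shift_words CARD('a) t u)"
    then have "x \<in> weight_words (t + CARD('a) + m)"
      by (rule shift_words_weight_words[OF one_less_CARD_field t(1) u])
    then show "p @ x \<in> weight_words w"
      using append_in_weight_words[OF t(2), of x "t + CARD('a) + m"] t(3) w by (simp add: ac_simps)
  qed
  then show ?thesis
    by (simp only: pt append_assoc append_Cons append_Nil sum_list_fmzl_insert_front)
qed

section \<open>Reduction of an arbitrary word to spanning words\<close>

lemma length_le_sum_list: "u \<in> indices \<Longrightarrow> length u \<le> sum_list u"
  by (induction u) (auto simp: indices_def)

text \<open>A later letter q + s is traded for the two letters q and s with opposite sign, up to
  small terms. The word grows while its weight stays fixed, so this stops, and the first letter is
  untouched.\<close>

lemma fmzl_first_letter_less:
  fixes w :: nat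
  defines "S \<equiv> AK.span (fmzl ` (basis_words CARD('a) \<inter> weight_words w)) :: 'a::{field,finite} AK set"
  assumes "t < CARD('a)" "t # u \<in> weight_words w"
  shows "fmzl (t # u) \<in> near_space w S"
  using assms(3)
proof (induction "w - length u" arbitrary: u rule: less_induct)
  case less
  let ?q = "CARD('a)"
  have S: "AK.subspace S" unfolding S_def by (rule AK.subspace_span)
  have u: "0 < t" "u \<in> indices" "t + sum_list u = w"
    using less.prems by (auto simp: weight_words_def Cons_in_indices)
  consider (big) c where "c \<in> set u" "?q < c"
    | (last) "u \<noteq> []" "last u = ?q"
    | (tail) "u \<in> tail_words ?q"
    using u(2) by (force simp: tail_words_def dest: last_in_set)
  then show ?case
  proof cases
    case big
    then obtain p u' where split: "u = p @ c # u'" by (meson split_list)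
    define s where "s = c - ?q"
    have c: "c = ?q + s" "0 < s" using big(2) by (auto simp: s_def)
    have words: "t # p \<in> weight_words (t + sum_list p)" "s # u' \<in> weight_words (s + sum_list u')"
      using u c by (auto simp: split weight_words_def Cons_in_indices append_in_indices)
    have "(\<Sum>x\<leftarrow>insert_front ?q (s # u'). fmzl ((t # p) @ x)) \<in> near_space w S"
      by (rule insert_front_near_space[OF S _ words]) (use u(3) c in \<open>auto simp: split\<close>)
    then have sum: "fmzl (t # p @ ?q # s # u') + fmzl (t # u) \<in> near_space w S"
      by (simp add: split c)
    have prems: "t # p @ ?q # s # u' \<in> weight_words w"
      using u c CARD_field_pos[where 'a='a]
      by (auto simp: split weight_words_def Cons_in_indices append_in_indices)
    \<comment> \<open>Length is bounded by weight, so the truncated difference in the induction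
      measure really decreases.\<close>
    have "length (p @ ?q # s # u') \<le> sum_list (p @ ?q # s # u')"
      using prems by (intro length_le_sum_list) (simp add: weight_words_def Cons_in_indices)
    then have prefix: "fmzl (t # p @ ?q # s # u') \<in> near_space w S"
      using prems u(1,3) c by (intro less.hyps) (auto simp: split)
    then show ?thesis using near_space_diff[OF S sum prefix] by simp
  next
    case last
    then obtain p where split: "u = p @ [?q]" by (metis append_butlast_last_id)
    have words: "t # p \<in> weight_words (t + sum_list p)" "[] \<in> weight_words 0"
      using u by (auto simp: split weight_words_def Cons_in_indices append_in_indices Nil_in_indices)
    \<comment> \<open>With nothing behind q there is no merged word, so the relation makes the word
      itself small.\<close>
    have "(\<Sum>x\<leftarrow>insert_front ?q []. fmzl ((t # p) @ x)) \<in> near_space w S"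
      by (rule insert_front_near_space[OF S _ words]) (use u(3) in \<open>auto simp: split\<close>)
    then show ?thesis by (simp add: split)
  next
    case tail
    show ?thesis
    proof (cases "t # u = [?q - 1]")
      case True
      then show ?thesis
        using fmzl_CARD_minus_1 AK.subspace_0[OF S] by (metis near_space_base)
    next
      case False
      then have "t # u \<in> basis_words ?q"
        using tail u(1) assms(2) by (auto simp: basis_words_def)
      then have "fmzl (t # u) \<in> S"
        unfolding S_def using less.prems by (intro AK.span_base) blast
      then show ?thesis by (rule near_space_base)
    qed
  qed
qed

text \<open>For t at least q put t = (q-1) + s. Inserting q-1 into (s,u) gives an exact relation in
  which every other word starts with q-1 or s, both smaller than t.\<close>

lemma fmzl_in_near_space:
  fixes w :: nat
  defines "S \<equiv> AK.span (fmzl ` (basis_words CARD('a) \<inter> weight_words w)) :: 'a::{field,finite} AK set"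
  assumes "u \<in> weight_words w"
  shows "fmzl u \<in> near_space w S"
proof -
  let ?q = "CARD('a)"
  have S: "AK.subspace S" unfolding S_def by (rule AK.subspace_span)
  have Cons: "fmzl (t # u) \<in> near_space w S" if "t # u \<in> weight_words w" for t u
    using that
  proof (induction t arbitrary: u rule: less_induct)
    case (less t)
    show ?case
    proof (cases "t < ?q")
      case True
      then show ?thesis unfolding S_def by (rule fmzl_first_letter_less) (rule less.prems)
    next
      case False
      define s where "s = t - (?q - 1)"
      have q: "1 < ?q" by (rule one_less_CARD_field)
      have s: "t = ?q - 1 + s" "0 < s" "s < t" "?q - 1 < t" using False q by (auto simp: s_def)
      have su: "s # u \<in> weight_words (w - (?q - 1))" and w: "w = ?q - 1 + (w - (?q - 1))"
        using less.prems s by (auto simp: weight_words_def Cons_in_indices)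
      have words: "x \<in> weight_words w" if "x \<in> set (insert_letter (?q - 1) (s # u))" for x
        using insert_letter_weight_words[OF _ su that] w q by simp
      have "fmzl ((?q - 1) # s # u) \<in> near_space w S"
        by (rule less.IH[OF s(4)]) (rule words, simp)
      moreover have "(\<Sum>x\<leftarrow>insert_letter (?q - 1) u. fmzl (s # x)) \<in> near_space w S"
      proof (rule near_space_sum_list[OF S])
        fix x assume "x \<in> set (insert_letter (?q - 1) u)"
        then show "fmzl (s # x) \<in> near_space w S"
          by (intro less.IH[OF s(3)] words) simp
      qed
      ultimately have "0 - fmzl ((?q - 1) # s # u)
          - (\<Sum>x\<leftarrow>insert_letter (?q - 1) u. fmzl (s # x)) \<in> near_space w S"
        by (intro near_space_diff[OF S] near_space_base[OF AK.subspace_0[OF S]])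
      moreover have "fmzl ((?q - 1) # s # u) + (fmzl (t # u)
          + (\<Sum>x\<leftarrow>insert_letter (?q - 1) u. fmzl (s # x))) = (0 :: 'a AK)"
        using sum_list_fmzl_insert_letter[of "s # u", where 'a='a] s(1) by (simp add: o_def)
      then have "fmzl (t # u) = 0 - fmzl ((?q - 1) # s # u)
          - (\<Sum>x\<leftarrow>insert_letter (?q - 1) u. fmzl (s # x) :: 'a AK)"
        by (simp add: algebra_simps eq_neg_iff_add_eq_0)
      ultimately show ?thesis by simp
    qed
  qed
  show ?thesis
  proof (cases u)
    case Nil
    then have "u \<in> basis_words ?q" by (simp add: basis_words_def)
    then have "fmzl u \<in> S" unfolding S_def using assms(2) by (intro AK.span_base) blast
    then show ?thesis by (rule near_space_base)
  qed (use Cons assms(2) in simp)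
qed

lemma fmzl_in_span_basis_words:
  assumes "u \<in> weight_words w"
  shows "fmzl u \<in> AK.span (fmzl ` (basis_words CARD('a) \<inter> weight_words w) :: 'a::{field,finite} AK set)"
proof (rule AK.nakayama_subspace[OF one_notin_vanishing_at_0 _ AK.subspace_span finite_weight_words _ assms])
  show "x + y * z / (1 - v) \<in> vanishing_at_0"
    if "x \<in> vanishing_at_0" "y \<in> vanishing_at_0" "z \<in> vanishing_at_0" "v \<in> vanishing_at_0"
    for x y z v :: "'a poly fract"
    by (intro vanishing_at_0_add vanishing_at_0_mult_divide that)
qed (use fmzl_in_near_space[of _ w, where 'a='a] in \<open>auto simp: near_space_def\<close>)

section \<open>Passage to the finite multiple zeta values\<close>

lemma nested_space_AK_of:
  fixes f :: "nat \<Rightarrow> 'a::{field,finite} poly fract"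
  assumes "f \<in> nested_space w"
  shows "almost_integral f \<and> AK_of f \<in> AK.span (fmzl ` (basis_words CARD('a) \<inter> weight_words w))"
  using assms
proof induction
  case (nested_space_gen u)
  then have "u \<in> weight_words w" by (simp add: weight_words_def)
  then show ?case
    using fmzl_in_span_basis_words[of u w, where 'a='a] almost_integral_nested_sum
    by (auto simp: fmzl_def)
next
  case nested_space_zero
  then show ?case by (simp add: almost_integral_const AK_of_zero AK.span_zero)
next
  case (nested_space_add f g)
  then show ?case by (simp add: almost_integral_add AK_of_add AK.span_add)
next
  case (nested_space_scale f c)
  then show ?case
    by (simp add: almost_integral_mult almost_integral_const AK_of_scale AK.span_scale)
qed

lemma fmzv_space_subset:
  "fmzv_space w \<subseteq> AK.span (fmzl ` (basis_words CARD('a) \<inter> weight_words w) :: 'a::{field,finite} AK set)"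
  unfolding fmzv_space_def
proof (rule AK.span_minimal[OF _ AK.subspace_span], safe)
  fix ss assume "ss \<in> indices" "w = sum_list ss"
  then show "fmzv ss \<in> AK.span (fmzl ` (basis_words CARD('a) \<inter> weight_words (sum_list ss)) :: 'a AK set)"
    unfolding fmzv_eq_AK_of using nested_space_AK_of[OF truncated_mzv_in_nested_space] by blast
qed

subsection \<open>Counting the spanning words\<close>

definition weight_gf :: "nat list set \<Rightarrow> rat fps" where
  "weight_gf T = Abs_fps (\<lambda>n. of_nat (card (T \<inter> weight_words n)))"

lemma weight_gf_Un:
  assumes "A \<inter> B = {}"
  shows "weight_gf (A \<union> B) = weight_gf A + weight_gf B"
proof (rule fps_ext)
  fix n
  have "card ((A \<union> B) \<inter> weight_words n) = card (A \<inter> weight_words n) + card (B \<inter> weight_words n)"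
    using assms finite_weight_words[of n] by (subst card_Un_disjoint[symmetric]) (auto simp: Int_Un_distrib2)
  then show "fps_nth (weight_gf (A \<union> B)) n = fps_nth (weight_gf A + weight_gf B) n"
    by (simp add: weight_gf_def)
qed

lemma weight_gf_singleton:
  assumes "u \<in> indices"
  shows "weight_gf {u} = fps_X ^ sum_list u"
proof (rule fps_ext)
  fix n
  have "{u} \<inter> weight_words n = (if sum_list u = n then {u} else {})"
    using assms by (auto simp: weight_words_def)
  then show "fps_nth (weight_gf {u}) n = fps_nth (fps_X ^ sum_list u) n"
    by (auto simp: weight_gf_def fps_X_power_nth)
qed

lemma weight_gf_Cons:
  assumes "T \<subseteq> indices" "finite J" "0 \<notin> J"
  shows "weight_gf {i # u | i u. i \<in> J \<and> u \<in> T} = (\<Sum>i\<in>J. fps_X ^ i) * weight_gf T"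
proof (rule fps_ext)
  fix n
  have "{i # u | i u. i \<in> J \<and> u \<in> T} \<inter> weight_words n
      = (\<Union>i\<in>{i\<in>J. i \<le> n}. (#) i ` (T \<inter> weight_words (n - i)))"
  proof safe
    fix i u assume "i \<in> J" "u \<in> T" "i # u \<in> weight_words n"
    then show "i # u \<in> (\<Union>i\<in>{i\<in>J. i \<le> n}. (#) i ` (T \<inter> weight_words (n - i)))"
      by (intro UN_I[of i]) (auto simp: weight_words_def Cons_in_indices)
  next
    fix i u assume "i \<in> J" "i \<le> n" "u \<in> weight_words (n - i)"
    then show "i # u \<in> weight_words n"
      using Cons_in_weight_words[of i u "n - i"] assms(3) by (cases i) auto
  qed auto
  then have "card ({i # u | i u. i \<in> J \<and> u \<in> T} \<inter> weight_words n)
      = (\<Sum>i\<in>{i\<in>J. i \<le> n}. card ((#) i ` (T \<inter> weight_words (n - i))))"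
    using assms(2) finite_weight_words by (simp only:) (rule card_UN_disjoint, auto)
  also have "\<dots> = (\<Sum>i\<in>J. if i \<le> n then card (T \<inter> weight_words (n - i)) else 0)"
    using assms(2) by (simp add: card_image sum.inter_filter)
  finally show "fps_nth (weight_gf {i # u | i u. i \<in> J \<and> u \<in> T}) n
      = fps_nth ((\<Sum>i\<in>J. fps_X ^ i) * weight_gf T) n"
    by (simp add: weight_gf_def sum_distrib_right fps_sum_nth fps_X_power_mult_nth if_distrib not_less
        cong: if_cong) (auto intro!: sum.cong)
qed

lemma sum_fps_X_power: "(1 - fps_X) * (\<Sum>i=1..n. fps_X ^ i) = fps_X * (1 - fps_X ^ n :: rat fps)"
proof (induction n)
  case (Suc n)
  have "(1 - fps_X) * (\<Sum>i=1..Suc n. fps_X ^ i)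
      = (1 - fps_X) * (\<Sum>i=1..n. fps_X ^ i) + (1 - fps_X) * (fps_X ^ Suc n :: rat fps)"
    by (simp add: distrib_left)
  also have "\<dots> = fps_X * (1 - fps_X ^ Suc n)"
    unfolding Suc.IH by (simp add: algebra_simps)
  finally show ?case .
qed simp

text \<open>Prepending a letter at most q to a tail word yields each nonempty tail word once, and in
  addition the inadmissible word \<open>[q]\<close>.\<close>

lemma weight_gf_tail_words:
  assumes "0 < q"
  shows "weight_gf (tail_words q) * (1 - (\<Sum>i=1..q. fps_X ^ i)) = 1 - fps_X ^ q"
proof -
  let ?T = "tail_words q"
  have "{i # u | i u. i \<in> {1..q} \<and> u \<in> ?T} = (?T - {[]}) \<union> {[q]}"
  proof (intro set_eqI iffI)
    fix x assume "x \<in> (?T - {[]}) \<union> {[q]}"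
    then show "x \<in> {i # u | i u. i \<in> {1..q} \<and> u \<in> ?T}"
      using assms by (cases x) (auto simp: tail_words_def Cons_in_indices Nil_in_indices split: if_splits)
  qed (use assms in \<open>auto simp: tail_words_def Cons_in_indices\<close>)
  then have "(\<Sum>i=1..q. fps_X ^ i) * weight_gf ?T = weight_gf ((?T - {[]}) \<union> {[q]})"
    by (subst weight_gf_Cons[symmetric]) (auto simp: tail_words_def)
  also have "\<dots> = weight_gf (?T - {[]}) + fps_X ^ q"
    using assms by (subst weight_gf_Un) (auto simp: tail_words_def weight_gf_singleton indices_def)
  finally have 1: "(\<Sum>i=1..q. fps_X ^ i) * weight_gf ?T = weight_gf (?T - {[]}) + fps_X ^ q" .
  have "?T = (?T - {[]}) \<union> {[]}" by (auto simp: tail_words_def Nil_in_indices)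
  then have "weight_gf ?T = weight_gf ((?T - {[]}) \<union> {[]})" by simp
  also have "\<dots> = weight_gf (?T - {[]}) + 1"
    by (subst weight_gf_Un) (auto simp: weight_gf_singleton Nil_in_indices)
  finally show ?thesis using 1 by (simp add: algebra_simps)
qed

text \<open>Likewise, prepending a letter below q to a tail word yields the nonempty spanning words
  together with the removed word \<open>[q - 1]\<close>.\<close>

lemma weight_gf_basis_words:
  assumes "1 < q"
  shows "weight_gf (basis_words q) * (1 - (\<Sum>i=1..q. fps_X ^ i)) = 1 - fps_X ^ (q - 1)"
proof -
  let ?T = "tail_words q" and ?B = "basis_words q"
  let ?s = "\<lambda>n. \<Sum>i=1..n. fps_X ^ i :: rat fps"
  have "{t # u | t u. t \<in> {1..q-1} \<and> u \<in> ?T} = (?B - {[]}) \<union> {[q - 1]}"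
    using assms by (auto simp: basis_words_def tail_words_def Nil_in_indices)
  then have "?s (q - 1) * weight_gf ?T = weight_gf ((?B - {[]}) \<union> {[q - 1]})"
    by (subst weight_gf_Cons[symmetric]) (auto simp: tail_words_def)
  also have "\<dots> = weight_gf (?B - {[]}) + fps_X ^ (q - 1)"
    using assms by (subst weight_gf_Un) (auto simp: basis_words_def weight_gf_singleton indices_def)
  finally have 1: "?s (q - 1) * weight_gf ?T = weight_gf (?B - {[]}) + fps_X ^ (q - 1)" .
  have "?B = (?B - {[]}) \<union> {[]}" by (auto simp: basis_words_def)
  then have "weight_gf ?B = weight_gf ((?B - {[]}) \<union> {[]})" by simp
  also have "\<dots> = weight_gf (?B - {[]}) + 1"
    by (subst weight_gf_Un) (auto simp: weight_gf_singleton Nil_in_indices)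
  finally have B: "weight_gf ?B = ?s (q - 1) * weight_gf ?T + 1 - fps_X ^ (q - 1)"
    using 1 by simp
  \<comment> \<open>The factor 1 - X turns both finite geometric sums into closed form; it is
    cancelled afterwards.\<close>
  have "(1 - fps_X) * (weight_gf ?B * (1 - ?s q))
      = ((1 - fps_X) * ?s (q - 1)) * (weight_gf ?T * (1 - ?s q))
        + (1 - fps_X ^ (q - 1)) * ((1 - fps_X) - (1 - fps_X) * ?s q)"
    unfolding B by (simp add: algebra_simps)
  also have "\<dots> = (1 - fps_X) * (1 - fps_X ^ (q - 1))"
    unfolding sum_fps_X_power weight_gf_tail_words[OF order.strict_trans[OF zero_less_one assms]]
    by (simp add: algebra_simps)
  finally have "(1 - fps_X) * (weight_gf ?B * (1 - ?s q)) = (1 - fps_X) * (1 - fps_X ^ (q - 1))" .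
  moreover have "(1 - fps_X :: rat fps) \<noteq> 0"
  proof
    assume "(1 - fps_X :: rat fps) = 0"
    then have "fps_nth (1 - fps_X :: rat fps) 0 = 0" by simp
    then show False by simp
  qed
  ultimately show ?thesis by simp
qed

lemma card_basis_words:
  assumes "1 < q"
  shows "of_nat (card (basis_words q \<inter> weight_words w)) = D_AK q w"
proof -
  let ?d = "1 - (\<Sum>i=1..q. fps_X ^ i) :: rat fps"
  have "fps_nth ?d 0 = 1" by (simp add: fps_sum_nth)
  then have "?d \<noteq> 0" by auto
  moreover have "weight_gf (basis_words q) * ?d = Abs_fps (D_AK q) * ?d"
    unfolding weight_gf_basis_words[OF assms] D_AK_expansion ..
  ultimately have "weight_gf (basis_words q) = Abs_fps (D_AK q)" by simp
  then have "fps_nth (weight_gf (basis_words q)) w = fps_nth (Abs_fps (D_AK q)) w" by simp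
  then show ?thesis by (simp add: weight_gf_def)
qed

theorem theorem4p3:
  fixes w :: nat
  shows "of_nat (AK.dim (fmzv_space w :: 'a::{field,finite} AK set)) \<le> D_AK CARD('a) w"
proof -
  let ?B = "basis_words CARD('a) \<inter> weight_words w"
  have "finite ?B" using finite_weight_words by blast
  then have "AK.dim (fmzv_space w :: 'a AK set) \<le> card (fmzl ` ?B :: 'a AK set)"
    by (intro AK.dim_le_card[OF fmzv_space_subset] finite_imageI)
  \<comment> \<open>Different words may have equal values, so only an inequality is available
    here.\<close>
  also have "\<dots> \<le> card ?B" by (rule card_image_le[OF \<open>finite ?B\<close>])
  finally have "(of_nat (AK.dim (fmzv_space w :: 'a AK set)) :: rat) \<le> of_nat (card ?B)" by simp
  also have "\<dots> = D_AK CARD('a) w" by (rule card_basis_words[OF one_less_CARD_field])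
  finally show ?thesis .
qed

end
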